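(* Let $\lambda\in\mathrm{Spec}_{\mathrm{disc}}\,M$ and $\mu:=\mathrm{dist}[\lambda,\mathrm{Spec}\,M\setminus\{\lambda\}]>0$. Assume that $$\lim_{n\to\infty}\|\Pi_nM^k\Pi_n\psi-\lambda^k\psi\|=0,\qquad k=0,1,2,\ \text{whenever } M\psi=\lambda\psi,$$ and that $w_0,w_1\ge 0$ do not vanish simultaneously. Let $0<\delta<\mu/4$ be fixed. Let $$0\le\varepsilon<\frac{\delta^2\mu^2}{2(2\delta^2+3\mu^2)\,[w_0+w_1(\mu/4+|\lambda|)]}.$$ Then there exists $N>0$, depending (for the given $M$, $\lambda$, $(\Pi_n)$) only upon $\delta$, $w_0$ and $w_1$, such that for all $(Q_n)_{n=1}^\infty\in\mathcal{P}_{\varepsilon,\bar w}$, where $\bar w=(w_0,w_1)$, and all $n>N$, $$\mathrm{Spec}(P_n+Q_n)\cap\{z\in\mathbb{C}:\delta\le|z-\lambda|\le\mu/4\}=\varnothing\quad\text{and}\quad \mathrm{Spec}(P_n+Q_n)\cap\{z\in\mathbb{C}:|z-\lambda|<\delta\}\neq\varnothing.$$ Moreover, counting multiplicities, the numbers of eigenvalues of $P_n$ and of $P_n+Q_n$ in $\{|z-\lambda|<\delta\}$ coincide.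
   Context: $M$ is a (possibly unbounded) self-adjoint operator with dense domain $\mathrm{Dom}\,M$ in a separable complex Hilbert space $\mathcal{H}$. $\mathrm{Spec}_{\mathrm{disc}}\,M$ is the set of isolated eigenvalues of $M$ of finite multiplicity; it is implicit that $\mathrm{Spec}\,M\setminus\{\lambda\}$ is nonempty, so $\mu$ is finite. $(\Pi_n)_{n\in\mathbb{N}}$ is a sequence of orthogonal projections on $\mathcal{H}$ whose ranges $\mathcal{L}_n:=\mathrm{Ran}\,\Pi_n$ are finite-dimensional and contained in $\mathrm{Dom}\,M^2$. For $z\in\mathbb{C}$, $$P_n(z):=\Pi_n(z-M)^2|_{\mathcal{L}_n}=z^2-2zM_n+[M^2]_n,\qquad M_n:=\Pi_nM|_{\mathcal{L}_n},\quad [M^2]_n:=\Pi_nM^2|_{\mathcal{L}_n}.$$ For a matrix polynomial $P$, $\mathrm{Spec}\,P:=\{z\in\mathbb{C}:\det P(z)=0\}$; its elements are the eigenvalues of $P$, and the multiplicity of an eigenvalue is its multiplicity as a zero of $\det P(z)$. Matrix norms are operator norms. $\mathcal{P}_{\varepsilon,\bar w}$ denotes the set of sequences $(Q_n)_{n=1}^\infty$ of linear matrix polynomials $Q_n(z)=F_nz-G_n$, where $F_n,G_n$ are square matrices of size $\dim\mathcal{L}_n$ (operators on $\mathcal{L}_n$), constant in $z$, with $\|G_n\|\le w_0\varepsilon$ and $\|F_n\|\le w_1\varepsilon$ for all $n$. *)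

theory Defs
  imports
    "HOL-Analysis.Analysis"
    "HOL-Complex_Analysis.Complex_Analysis"
    "Jordan_Normal_Form.Determinant"
begin

section \<open>Complex Hilbert spaces\<close>

text \<open>
  The inner product is antilinear in the first and linear in the second argument. Positive
  definiteness is not listed because it follows from the last axiom: \<^const>\<open>sqrt\<close> is negative
  on negative reals, while the norm of a \<^class>\<open>banach\<close> space is nonnegative and vanishes
  only at zero.
\<close>

class complex_hilbert = banach +
  fixes scaleC :: "complex \<Rightarrow> 'a \<Rightarrow> 'a"  (infixr "*\<^sub>C" 75)
    and cinner :: "'a \<Rightarrow> 'a \<Rightarrow> complex"
  assumes scaleC_add_right: "a *\<^sub>C (x + y) = a *\<^sub>C x + a *\<^sub>C y"
    and scaleC_add_left: "(a + b) *\<^sub>C x = a *\<^sub>C x + b *\<^sub>C x"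
    and scaleC_scaleC: "a *\<^sub>C (b *\<^sub>C x) = (a * b) *\<^sub>C x"
    and scaleR_scaleC: "r *\<^sub>R x = complex_of_real r *\<^sub>C x"
    and cinner_commute: "cinner x y = cnj (cinner y x)"
    and cinner_add_right: "cinner x (y + z) = cinner x y + cinner x z"
    and cinner_scaleC_right: "cinner x (a *\<^sub>C y) = a * cinner x y"
    and norm_eq_sqrt_cinner: "norm x = sqrt (Re (cinner x x))"

instantiation complex :: complex_hilbert
begin

definition scaleC_complex :: "complex \<Rightarrow> complex \<Rightarrow> complex" where
  "scaleC_complex a x = a * x"

definition cinner_complex :: "complex \<Rightarrow> complex \<Rightarrow> complex" where
  "cinner_complex x y = cnj x * y"

instance
  by standard
    (simp_all add: scaleC_complex_def cinner_complex_def algebra_simps scaleR_conv_of_real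
      cmod_def power2_eq_square)

end

lemma scaleC_one: "1 *\<^sub>C (x :: 'a :: complex_hilbert) = x"
  using scaleR_scaleC[of 1 x] by simp

global_interpretation complex_vector:
  vector_space "scaleC :: complex \<Rightarrow> 'a \<Rightarrow> 'a :: complex_hilbert"
  by standard (simp_all add: scaleC_add_right scaleC_add_left scaleC_scaleC scaleC_one)

definition finite_dim :: "'a :: complex_hilbert set \<Rightarrow> bool" where
  "finite_dim L \<longleftrightarrow> (\<exists>B. finite B \<and> complex_vector.span B = L)"


section \<open>Operators with a domain\<close>

text \<open>
  An operator with domain \<open>D\<close> is a function on the whole type of which only the values on \<open>D\<close>
  are relevant.
\<close>

definition linear_op_on :: "'a :: complex_hilbert set \<Rightarrow> ('a \<Rightarrow> 'a) \<Rightarrow> bool" where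
  "linear_op_on D T \<longleftrightarrow>
     complex_vector.subspace D \<and>
     (\<forall>x\<in>D. \<forall>y\<in>D. T (x + y) = T x + T y) \<and>
     (\<forall>a. \<forall>x\<in>D. T (a *\<^sub>C x) = a *\<^sub>C T x)"

definition adjoint_graph :: "'a :: complex_hilbert set \<Rightarrow> ('a \<Rightarrow> 'a) \<Rightarrow> ('a \<times> 'a) set" where
  "adjoint_graph D T = {(y, z). \<forall>x\<in>D. cinner y (T x) = cinner z x}"

definition self_adjoint_op :: "'a :: complex_hilbert set \<Rightarrow> ('a \<Rightarrow> 'a) \<Rightarrow> bool" where
  "self_adjoint_op D T \<longleftrightarrow>
     linear_op_on D T \<and> closure D = UNIV \<and> adjoint_graph D T = {(x, T x) |x. x \<in> D}"

definition op_resolvent_set :: "'a :: complex_hilbert set \<Rightarrow> ('a \<Rightarrow> 'a) \<Rightarrow> complex set" where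
  "op_resolvent_set D T =
     {z. bij_betw (\<lambda>x. z *\<^sub>C x - T x) D UNIV \<and>
         bounded_linear (inv_into D (\<lambda>x. z *\<^sub>C x - T x))}"

definition op_spectrum :: "'a :: complex_hilbert set \<Rightarrow> ('a \<Rightarrow> 'a) \<Rightarrow> complex set" where
  "op_spectrum D T = - op_resolvent_set D T"

definition op_eigenspace :: "'a :: complex_hilbert set \<Rightarrow> ('a \<Rightarrow> 'a) \<Rightarrow> complex \<Rightarrow> 'a set" where
  "op_eigenspace D T z = {x \<in> D. T x = z *\<^sub>C x}"

definition discrete_spectrum :: "'a :: complex_hilbert set \<Rightarrow> ('a \<Rightarrow> 'a) \<Rightarrow> complex set" where
  "discrete_spectrum D T =
     {z. z isolated_in op_spectrum D T \<and> op_eigenspace D T z \<noteq> {0} \<and>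
         finite_dim (op_eigenspace D T z)}"

definition domain_square :: "'a set \<Rightarrow> ('a \<Rightarrow> 'a) \<Rightarrow> 'a set" where
  "domain_square D T = {x \<in> D. T x \<in> D}"

definition orthogonal_projection :: "('a :: complex_hilbert \<Rightarrow> 'a) \<Rightarrow> bool" where
  "orthogonal_projection P \<longleftrightarrow>
     linear_op_on UNIV P \<and> (\<forall>x. P (P x) = P x) \<and> (\<forall>x y. cinner (P x) y = cinner x (P y))"


section \<open>Operators on a finite-dimensional subspace\<close>

text \<open>
  The following notions are used for finite-dimensional subspaces \<open>L\<close> and linear maps
  \<open>T\<close> with \<open>T ` L \<subseteq> L\<close>. The quotient in the norm is \<open>0\<close> at \<open>x = 0\<close>.
\<close>

definition op_norm_on :: "'a :: complex_hilbert set \<Rightarrow> ('a \<Rightarrow> 'a) \<Rightarrow> real" where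
  "op_norm_on L T = (SUP x\<in>L. norm (T x) / norm x)"

definition orthonormal_basis :: "'a :: complex_hilbert set \<Rightarrow> 'a list \<Rightarrow> bool" where
  "orthonormal_basis L b \<longleftrightarrow>
     (\<forall>i<length b. \<forall>j<length b. cinner (b ! i) (b ! j) = (if i = j then 1 else 0)) \<and>
     complex_vector.span (set b) = L"

definition matrix_of :: "'a :: complex_hilbert list \<Rightarrow> ('a \<Rightarrow> 'a) \<Rightarrow> complex mat" where
  "matrix_of b T = Matrix.mat (length b) (length b) (\<lambda>(i, j). cinner (b ! i) (T (b ! j)))"

text \<open>
  The determinant of an endomorphism does not depend on the basis used for its matrix, so any
  choice will do.
\<close>

definition det_on :: "'a :: complex_hilbert set \<Rightarrow> ('a \<Rightarrow> 'a) \<Rightarrow> complex" where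
  "det_on L T = Determinant.det (matrix_of (SOME b. orthonormal_basis L b) T)"


section \<open>Matrix polynomials\<close>

text \<open>
  A matrix polynomial is given by its values \<open>P z\<close>, which are operators on \<open>L\<close>.
  The multiplicity of an eigenvalue is its order as a zero of \<open>det P(z)\<close>. The sum below
  is meaningful if \<open>det P(z)\<close> does not vanish identically, so that \<open>pencil_spectrum L P\<close>
  is finite; this is the case whenever the leading coefficient is the identity, as it is
  for \<open>quadratic_pencil\<close> and its perturbations by polynomials of degree at most one.
\<close>

definition pencil_spectrum ::
  "'a :: complex_hilbert set \<Rightarrow> (complex \<Rightarrow> 'a \<Rightarrow> 'a) \<Rightarrow> complex set" where
  "pencil_spectrum L P = {z. det_on L (P z) = 0}"

definition count_eigenvalues ::
  "'a :: complex_hilbert set \<Rightarrow> (complex \<Rightarrow> 'a \<Rightarrow> 'a) \<Rightarrow> complex set \<Rightarrow> int" where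
  "count_eigenvalues L P S =
     (\<Sum>z\<in>pencil_spectrum L P \<inter> S. zorder (\<lambda>w. det_on L (P w)) z)"

definition quadratic_pencil ::
  "('a :: complex_hilbert \<Rightarrow> 'a) \<Rightarrow> ('a \<Rightarrow> 'a) \<Rightarrow> complex \<Rightarrow> 'a \<Rightarrow> 'a" where
  "quadratic_pencil P T z = (\<lambda>x. P (((\<lambda>y. z *\<^sub>C y - T y) ^^ 2) x))"

lemma quadratic_pencil_expand:
  assumes "linear_op_on D T" "orthogonal_projection P" "range P \<subseteq> domain_square D T"
    and "x \<in> range P"
  shows "quadratic_pencil P T z x =
    (z ^ 2) *\<^sub>C x - (2 * z) *\<^sub>C P (T x) + P ((T ^^ 2) x)"
proof -
  have sub: "complex_vector.subspace D"
    and add: "\<And>u v. u \<in> D \<Longrightarrow> v \<in> D \<Longrightarrow> T (u + v) = T u + T v"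
    and scale: "\<And>a u. u \<in> D \<Longrightarrow> T (a *\<^sub>C u) = a *\<^sub>C T u"
    using assms(1) by (auto simp: linear_op_on_def)
  have Padd: "\<And>u v. P (u + v) = P u + P v" and Pscale: "\<And>a u. P (a *\<^sub>C u) = a *\<^sub>C P u"
    and Pid: "P x = x"
    using assms(2,4) by (auto simp: orthogonal_projection_def linear_op_on_def)
  have xD: "x \<in> D" "T x \<in> D"
    using assms(3,4) by (auto simp: domain_square_def)
  have D: "z *\<^sub>C x \<in> D" "(-1) *\<^sub>C T x \<in> D"
    using sub xD by (auto simp del: complex_vector.scale_minus_left
        intro: complex_vector.subspace_scale)
  have "T (z *\<^sub>C x - T x) = T (z *\<^sub>C x + (-1) *\<^sub>C T x)"
    by simp
  also have "\<dots> = z *\<^sub>C T x - T (T x)"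
    using add[OF D] scale[OF xD(1), of z] scale[OF xD(2), of "-1"] by simp
  finally have *: "T (z *\<^sub>C x - T x) = z *\<^sub>C T x - T (T x)" .
  have two: "(2 * z) *\<^sub>C T x = z *\<^sub>C T x + z *\<^sub>C T x"
    using complex_vector.scale_left_distrib[of z z "T x"] by (simp only: mult_2)
  have "((\<lambda>y. z *\<^sub>C y - T y) ^^ 2) x = z *\<^sub>C (z *\<^sub>C x - T x) - T (z *\<^sub>C x - T x)"
    by (simp add: numeral_2_eq_2)
  also have "\<dots> = (z ^ 2) *\<^sub>C x - (2 * z) *\<^sub>C T x + T (T x)"
    unfolding * two complex_vector.scale_right_diff_distrib scaleC_scaleC power2_eq_square
    by (simp only: algebra_simps)
  also have "\<dots> = (z ^ 2) *\<^sub>C x + ((- (2 * z)) *\<^sub>C T x + T (T x))"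
    by simp
  finally have "P (((\<lambda>y. z *\<^sub>C y - T y) ^^ 2) x) =
      (z ^ 2) *\<^sub>C x + ((- (2 * z)) *\<^sub>C P (T x) + P (T (T x)))"
    by (simp only: Padd Pscale Pid)
  moreover have "(T ^^ 2) x = T (T x)"
    by (simp add: numeral_2_eq_2)
  ultimately show ?thesis
    unfolding quadratic_pencil_def by simp
qed

definition linear_perturbations ::
  "(nat \<Rightarrow> 'a :: complex_hilbert set) \<Rightarrow> real \<Rightarrow> real \<times> real \<Rightarrow>
     (nat \<Rightarrow> complex \<Rightarrow> 'a \<Rightarrow> 'a) set" where
  "linear_perturbations L \<epsilon> w =
     {Q. \<exists>F G. \<forall>n\<ge>1.
        linear_op_on (L n) (F n) \<and> F n ` L n \<subseteq> L n \<and> op_norm_on (L n) (F n) \<le> snd w * \<epsilon> \<and>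
        linear_op_on (L n) (G n) \<and> G n ` L n \<subseteq> L n \<and> op_norm_on (L n) (G n) \<le> fst w * \<epsilon> \<and>
        (\<forall>z. \<forall>x\<in>L n. Q n z x = z *\<^sub>C F n x - G n x)}"

end

theory Submission
  imports Defs
begin

text \<open>
  The whole statement follows from one quantitative fact: for large \<open>n\<close> the unperturbed pencil
  satisfies \<open>norm (P z v) \<ge> \<delta>\<^sup>2 / 2 * norm v\<close> for all \<open>z\<close> in the closed annulus
  \<open>\<delta> \<le> cmod (z - lam) \<le> \<mu> / 4\<close> and all \<open>v\<close> in the range of the projection
  (\<open>pencil_lower_bound\<close>). The bound on \<open>\<epsilon>\<close> makes the perturbation smaller than this, so
  \<open>P + t Q\<close> is injective on the annulus for every \<open>t\<close> between 0 and 1. Hence the annulus contains no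
  eigenvalue, and Rouche's theorem along the homotopy \<open>det (P + t Q)\<close> shows that the zero count in the
  disc does not change (\<open>zero_count_homotopy\<close>). That this count is positive is seen for \<open>P\<close>
  itself: if \<open>\<psi>\<close> is an eigenvector, \<open>P lam (Pr \<psi>)\<close> is almost zero. An inverse of \<open>P\<close> that is
  holomorphic on the whole disc would obey at \<open>lam\<close> the bound it has on the circle, by the
  maximum principle, and this is incompatible with such an almost-kernel vector
  (\<open>det_on_has_zero\<close>).

  For the lower bound, write \<open>v = a + \<beta>\<close> with \<open>a\<close> in the eigenspace of \<open>lam\<close> and \<open>\<beta>\<close> orthogonal
  to it. The operator \<open>(z - M)\<^sup>2\<close> acts as \<open>(z - lam)\<^sup>2\<close> on the eigenspace, a number of modulus at
  least \<open>\<delta>\<^sup>2\<close> but arbitrary phase. On the complement it has positive real part, because \<open>lam\<close> is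
  at distance \<open>\<mu>\<close> from the rest of the spectrum and \<open>z\<close> is within \<open>\<mu> / 4\<close> of \<open>lam\<close>. Testing with
  \<open>w = c a + \<beta>\<close>, where \<open>c\<close> is a phase, therefore gives
  \<open>Re \<langle>w, (z - M)\<^sup>2 v\<rangle> \<ge> \<delta>\<^sup>2 * (norm v)\<^sup>2\<close>. The vector \<open>w\<close> differs from \<open>v\<close> only by an
  element of the eigenspace, so replacing it by its projection costs an error that the three convergence
  hypotheses make uniformly small on the finite-dimensional eigenspace (\<open>residual_le\<close>).

  The spectral input is the gap inequality \<open>norm (M x - lam x) \<ge> \<mu> * norm x\<close> for \<open>x\<close> in the
  domain and orthogonal to the eigenspace (\<open>spectral_gap\<close>). It is derived from scalar complex
  analysis rather than from the spectral theorem. If \<open>\<langle>x, R(z) x\<rangle>\<close> extends holomorphically to a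
  disc of radius \<open>r\<close> around a real \<open>t\<close>, then \<open>norm (R(t) x) \<le> norm x / r\<close>
  (\<open>norm_R_le_of_extension\<close>). For \<open>x\<close> in the range of \<open>M - lam\<close> the singularity at \<open>lam\<close> is
  removable, so this applies with \<open>r\<close> close to \<open>\<mu>\<close>.
\<close>

section \<open>Geometry of complex Hilbert spaces\<close>

text \<open>
  The norm axiom gives the real part; the imaginary part vanishes by conjugate symmetry.
\<close>

lemma cinner_self: "cinner x x = complex_of_real ((norm x)\<^sup>2)"
  for x :: "'a :: complex_hilbert"
proof -
  have "0 \<le> sqrt (Re (cinner x x))"
    using norm_ge_zero[of x] by (simp add: norm_eq_sqrt_cinner)
  hence "(norm x)\<^sup>2 = Re (cinner x x)"
    by (simp add: norm_eq_sqrt_cinner)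
  moreover have "Im (cinner x x) = 0"
    using arg_cong[OF cinner_commute[of x x], of Im] by simp
  ultimately show ?thesis
    by (simp add: complex_eq_iff)
qed

lemma cinner_add_left: "cinner (x + y) z = cinner x z + cinner y z"
  for x :: "'a :: complex_hilbert"
  by (metis cinner_add_right cinner_commute complex_cnj_add)

lemma cinner_scaleC_left: "cinner (a *\<^sub>C x) y = cnj a * cinner x y"
  for x :: "'a :: complex_hilbert"
  by (metis cinner_scaleC_right cinner_commute complex_cnj_mult)

lemma norm_scaleC: "norm (a *\<^sub>C x) = cmod a * norm x"
  for x :: "'a :: complex_hilbert"
proof -
  have "a * cnj a = complex_of_real (cmod a) ^ 2"
    by (metis complex_norm_square of_real_power)
  hence "complex_of_real ((norm (a *\<^sub>C x))\<^sup>2) = complex_of_real ((cmod a * norm x)\<^sup>2)"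
    unfolding cinner_self[symmetric] cinner_scaleC_left cinner_scaleC_right
    by (simp add: cinner_self power_mult_distrib flip: mult.assoc)
  hence "(norm (a *\<^sub>C x))\<^sup>2 = (cmod a * norm x)\<^sup>2"
    using of_real_eq_iff by blast
  thus ?thesis
    by (simp add: power2_eq_iff_nonneg)
qed

lemma norm_add_square: "(norm (x + y))\<^sup>2 = (norm x)\<^sup>2 + 2 * Re (cinner x y) + (norm y)\<^sup>2"
  for x :: "'a :: complex_hilbert"
proof -
  have "(norm (x + y))\<^sup>2 = Re (cinner (x + y) (x + y))"
    by (simp add: cinner_self)
  also have "\<dots> = Re (cinner x x) + Re (cinner x y) + Re (cinner y x) + Re (cinner y y)"
    by (simp add: cinner_add_left cinner_add_right)
  also have "Re (cinner y x) = Re (cinner x y)"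
    using arg_cong[OF cinner_commute[of y x], of Re] by simp
  finally show ?thesis
    by (simp add: cinner_self)
qed

text \<open>
  Since the triangle inequality of the norm is given, squaring it already yields the
  Cauchy-Schwarz inequality for the real part; rotating \<open>y\<close> by a phase makes
  \<open>cinner x y\<close> real.
\<close>

lemma norm_cinner_le: "cmod (cinner x y) \<le> norm x * norm y"
  for x :: "'a :: complex_hilbert"
proof (cases "cinner x y = 0")
  case False
  have re: "Re (cinner x u) \<le> norm x * norm u" for u :: 'a
  proof -
    have "(norm (x + u))\<^sup>2 \<le> (norm x + norm u)\<^sup>2"
      by (intro power_mono norm_triangle_ineq) simp
    thus ?thesis
      unfolding norm_add_square by (simp add: power2_eq_square algebra_simps)
  qed
  define c where "c = cnj (sgn (cinner x y))"
  have c: "cmod c = 1"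
    using False by (simp add: c_def norm_sgn)
  have "c * cinner x y = complex_of_real (cmod (cinner x y))"
    using False complex_norm_square[of "cinner x y"] unfolding c_def
    by (simp add: sgn_eq mult.commute power2_eq_square field_simps)
  hence "cmod (cinner x y) = Re (cinner x (c *\<^sub>C y))"
    by (simp add: cinner_scaleC_right)
  also have "\<dots> \<le> norm x * norm y"
    using re[of "c *\<^sub>C y"] by (simp add: norm_scaleC c)
  finally show ?thesis .
qed simp

lemma bounded_bilinear_cinner: "bounded_bilinear (cinner :: 'a :: complex_hilbert \<Rightarrow> 'a \<Rightarrow> complex)"
proof
  show "\<exists>K. \<forall>a b :: 'a. norm (cinner a b) \<le> norm a * norm b * K"
    by (rule exI[of _ 1]) (simp add: norm_cinner_le)
qed (simp_all add: cinner_add_left cinner_add_right scaleR_scaleC cinner_scaleC_left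
    cinner_scaleC_right scaleC_complex_def)

lemma bounded_bilinear_scaleC: "bounded_bilinear (scaleC :: complex \<Rightarrow> 'a \<Rightarrow> 'a :: complex_hilbert)"
proof
  show "\<exists>K. \<forall>a (b :: 'a). norm (a *\<^sub>C b) \<le> norm a * norm b * K"
    by (rule exI[of _ 1]) (simp add: norm_scaleC)
qed (simp_all add: scaleC_add_left scaleC_add_right scaleR_scaleC scaleC_complex_def
    mult.commute)

interpretation cinner: bounded_bilinear "cinner :: 'a :: complex_hilbert \<Rightarrow> 'a \<Rightarrow> complex"
  by (rule bounded_bilinear_cinner)

interpretation scaleC: bounded_bilinear "scaleC :: complex \<Rightarrow> 'a \<Rightarrow> 'a :: complex_hilbert"
  by (rule bounded_bilinear_scaleC)

lemma norm_add_square_orthogonal: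
  fixes x :: "'a :: complex_hilbert"
  assumes "cinner x y = 0"
  shows "(norm (x + y))\<^sup>2 = (norm x)\<^sup>2 + (norm y)\<^sup>2"
  by (simp add: norm_add_square assms)

lemma cinner_eq_0_commute: "cinner x y = 0 \<longleftrightarrow> cinner y x = 0"
  for x :: "'a :: complex_hilbert"
  by (metis cinner_commute complex_cnj_zero)

subsection \<open>Orthonormal bases of finite-dimensional subspaces\<close>

definition onb_proj :: "'a :: complex_hilbert list \<Rightarrow> 'a \<Rightarrow> 'a" where
  "onb_proj b x = (\<Sum>i<length b. cinner (b ! i) x *\<^sub>C b ! i)"

lemma onb_proj_in_span: "onb_proj b x \<in> complex_vector.span (set b)"
  unfolding onb_proj_def
  by (intro complex_vector.span_sum complex_vector.span_scale complex_vector.span_base) simp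

context
  fixes L :: "'a :: complex_hilbert set" and b :: "'a list"
  assumes onb: "orthonormal_basis L b"
begin

lemma onb_subspace: "complex_vector.subspace L"
  using onb by (auto simp: orthonormal_basis_def)

lemma onb_nth_in: "i < length b \<Longrightarrow> b ! i \<in> L"
  using onb by (auto simp: orthonormal_basis_def intro: complex_vector.span_base)

lemma onb_proj_in: "onb_proj b x \<in> L"
  using onb onb_proj_in_span[of b x] by (simp add: orthonormal_basis_def)

lemma cinner_onb:
  "i < length b \<Longrightarrow> j < length b \<Longrightarrow> cinner (b ! i) (b ! j) = (if i = j then 1 else 0)"
  using onb by (simp add: orthonormal_basis_def)

lemma cinner_nth_onb_sum:
  assumes "i < length b"
  shows "cinner (b ! i) (\<Sum>j<length b. c j *\<^sub>C b ! j) = c i"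
proof -
  have "cinner (b ! i) (\<Sum>j<length b. c j *\<^sub>C b ! j) = (\<Sum>j<length b. if i = j then c j else 0)"
    unfolding cinner.sum_right
    by (intro sum.cong) (simp_all add: cinner_scaleC_right cinner_onb assms)
  thus ?thesis
    using assms by simp
qed

lemma cinner_onb_basis_eq_0:
  assumes "\<And>i. i < length b \<Longrightarrow> cinner (b ! i) y = 0" and "u \<in> L"
  shows "cinner u y = 0"
proof -
  have "complex_vector.subspace {u. cinner u y = 0}"
    by (auto simp: complex_vector.subspace_def cinner_add_left cinner_scaleC_left cinner.zero_left)
  moreover have "set b \<subseteq> {u. cinner u y = 0}"
    using assms(1) by (auto simp: in_set_conv_nth)
  ultimately have "complex_vector.span (set b) \<subseteq> {u. cinner u y = 0}"
    by (intro complex_vector.span_minimal)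
  thus ?thesis
    using assms(2) onb by (auto simp: orthonormal_basis_def)
qed

lemma onb_eq_0:
  assumes "\<And>i. i < length b \<Longrightarrow> cinner (b ! i) y = 0" and "y \<in> L"
  shows "y = 0"
  using cinner_onb_basis_eq_0[OF assms] by (simp add: cinner_self)

lemma cinner_diff_onb_proj:
  assumes "u \<in> L"
  shows "cinner u (x - onb_proj b x) = 0"
  using _ assms
  by (rule cinner_onb_basis_eq_0) (simp add: cinner.diff_right onb_proj_def cinner_nth_onb_sum)

lemma onb_proj_same:
  assumes "x \<in> L"
  shows "onb_proj b x = x"
proof -
  have "x - onb_proj b x \<in> L"
    using assms onb_proj_in onb_subspace by (intro complex_vector.subspace_diff)
  hence "cinner (x - onb_proj b x) (x - onb_proj b x) = 0"
    by (rule cinner_diff_onb_proj)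
  thus ?thesis
    by (simp add: cinner_self)
qed

lemma onb_expansion:
  assumes "x \<in> L"
  shows "x = (\<Sum>i<length b. cinner (b ! i) x *\<^sub>C b ! i)"
  using onb_proj_same[OF assms] by (simp add: onb_proj_def)

lemma norm_onb: "i < length b \<Longrightarrow> norm (b ! i) = 1"
  using cinner_onb[of i i]
  by (simp add: norm_eq_sqrt_cinner)

lemma onb_sum_in: "(\<Sum>i<length b. c i *\<^sub>C b ! i) \<in> L"
  using onb_subspace onb_nth_in
  by (intro complex_vector.subspace_sum complex_vector.subspace_scale) auto

lemma linear_onb_sum:
  assumes "linear_op_on L T"
  shows "T (\<Sum>i<length b. c i *\<^sub>C b ! i) = (\<Sum>i<length b. c i *\<^sub>C T (b ! i))"
proof -
  have add: "\<And>x y. x \<in> L \<Longrightarrow> y \<in> L \<Longrightarrow> T (x + y) = T x + T y"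
    and scale: "\<And>a x. x \<in> L \<Longrightarrow> T (a *\<^sub>C x) = a *\<^sub>C T x"
    using assms by (auto simp: linear_op_on_def)
  have "T 0 = 0"
    using scale[of 0 0] complex_vector.subspace_0[OF onb_subspace] by simp
  have in_L: "(\<Sum>i\<in>I. c i *\<^sub>C b ! i) \<in> L" if "I \<subseteq> {..<length b}" for I
    using that onb_subspace onb_nth_in
    by (intro complex_vector.subspace_sum complex_vector.subspace_scale) auto
  have "T (\<Sum>i\<in>I. c i *\<^sub>C b ! i) = (\<Sum>i\<in>I. c i *\<^sub>C T (b ! i))"
    if "I \<subseteq> {..<length b}" for I
    using finite_subset[OF that finite_lessThan] that
  proof induction
    case (insert i I)
    have "T (\<Sum>i\<in>insert i I. c i *\<^sub>C b ! i) = T (c i *\<^sub>C b ! i + (\<Sum>i\<in>I. c i *\<^sub>C b ! i))"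
      using insert by simp
    also have "\<dots> = T (c i *\<^sub>C b ! i) + T (\<Sum>i\<in>I. c i *\<^sub>C b ! i)"
      using insert in_L onb_nth_in onb_subspace
      by (intro add complex_vector.subspace_scale) auto
    finally show ?case
      using insert by (simp add: scale onb_nth_in)
  qed (simp add: \<open>T 0 = 0\<close>)
  thus ?thesis by simp
qed

text \<open>Coordinates are bounded by the norm, so a linear map is controlled by its values on the basis.\<close>

lemma norm_linear_le_onb:
  assumes "linear_op_on L T" and x: "x \<in> L"
  shows "norm (T x) \<le> (\<Sum>i<length b. norm (T (b ! i))) * norm x"
proof -
  have "norm (T x) = norm (\<Sum>i<length b. cinner (b ! i) x *\<^sub>C T (b ! i))"
    using linear_onb_sum[OF assms(1), of "\<lambda>i. cinner (b ! i) x"] onb_expansion[OF x] by simp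
  also have "\<dots> \<le> (\<Sum>i<length b. norm (T (b ! i)) * norm x)"
  proof (intro sum_norm_le)
    fix i assume "i \<in> {..<length b}"
    hence "cmod (cinner (b ! i) x) \<le> norm x"
      using norm_cinner_le[of "b ! i" x] by (simp add: norm_onb)
    from mult_right_mono[OF this norm_ge_zero[of "T (b ! i)"]]
    show "norm (cinner (b ! i) x *\<^sub>C T (b ! i)) \<le> norm (T (b ! i)) * norm x"
      by (simp add: norm_scaleC mult.commute)
  qed
  finally show ?thesis
    by (simp add: sum_distrib_right)
qed

end

text \<open>Gram-Schmidt: each new spanning vector contributes its normalised residual, if nonzero.\<close>

lemma ex_orthonormal_basis:
  assumes "finite_dim L"
  obtains b where "orthonormal_basis L b"
proof -
  have "\<exists>b. orthonormal_basis (complex_vector.span B) b" if "finite B" for B :: "'a set"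
    using that
  proof induction
    case empty
    show ?case by (rule exI[of _ "[]"]) (simp add: orthonormal_basis_def)
  next
    case (insert x B)
    then obtain b where b: "orthonormal_basis (complex_vector.span B) b"
      by blast
    have span_b: "complex_vector.span (set b) = complex_vector.span B"
      using b by (simp add: orthonormal_basis_def)
    define p where "p = onb_proj b x"
    define y where "y = x - p"
    have p: "p \<in> complex_vector.span B"
      unfolding p_def by (rule onb_proj_in[OF b])
    have orth: "cinner u y = 0" if "u \<in> complex_vector.span B" for u
      unfolding y_def p_def by (rule cinner_diff_onb_proj[OF b that])
    show ?case
    proof (cases "y = 0")
      case True
      hence "complex_vector.span (insert x B) = complex_vector.span B"
        using p by (simp add: y_def complex_vector.span_redundant)
      thus ?thesis
        using b by auto
    next
      case False
      define e where "e = complex_of_real (inverse (norm y)) *\<^sub>C y"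
      have norm_e: "norm e = 1"
        using False by (simp add: e_def norm_scaleC norm_inverse)
      have y_e: "y = complex_of_real (norm y) *\<^sub>C e"
        using False by (simp add: e_def)
      have e: "cinner (b ! i) e = 0" "cinner e (b ! i) = 0" if "i < length b" for i
        using orth[OF onb_nth_in[OF b that]] cinner_eq_0_commute[of y "b ! i"]
        by (simp_all add: e_def cinner_scaleC_left cinner_scaleC_right)
      have "complex_vector.span (insert e B) = complex_vector.span (insert x B)"
      proof (rule antisym)
        have "y \<in> complex_vector.span (insert x B)"
          unfolding y_def using p complex_vector.span_mono[of B "insert x B"]
          by (intro complex_vector.span_diff) (auto intro: complex_vector.span_base)
        hence "e \<in> complex_vector.span (insert x B)"
          unfolding e_def by (rule complex_vector.span_scale)
        thus "complex_vector.span (insert e B) \<subseteq> complex_vector.span (insert x B)"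
          by (intro complex_vector.span_minimal) (auto intro: complex_vector.span_base)
        have "y \<in> complex_vector.span (insert e B)"
          by (subst y_e, intro complex_vector.span_scale complex_vector.span_base) simp
        moreover have "p \<in> complex_vector.span (insert e B)"
          using p complex_vector.span_mono[of B "insert e B"] by auto
        ultimately have "y + p \<in> complex_vector.span (insert e B)"
          by (rule complex_vector.span_add)
        hence "x \<in> complex_vector.span (insert e B)"
          by (simp add: y_def)
        thus "complex_vector.span (insert x B) \<subseteq> complex_vector.span (insert e B)"
          by (intro complex_vector.span_minimal) (auto intro: complex_vector.span_base)
      qed
      moreover have "complex_vector.span (set (b @ [e])) = complex_vector.span (insert e B)"
        using span_b complex_vector.span_insert[of e "set b"] complex_vector.span_insert[of e B]
        by simp
      moreover have "cinner e e = 1"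
        by (simp add: cinner_self norm_e)
      ultimately have "orthonormal_basis (complex_vector.span (insert x B)) (b @ [e])"
        unfolding orthonormal_basis_def
        using e cinner_onb[OF b] by (auto simp: nth_append less_Suc_eq)
      thus ?thesis by blast
    qed
  qed
  thus ?thesis
    using assms that unfolding finite_dim_def by blast
qed

section \<open>The spectral gap of a self-adjoint operator around an isolated point\<close>

text \<open>
  Log-convexity makes the ratios \<open>a (Suc n) / a n\<close> nondecreasing. If the first one exceeded \<open>q\<close>,
  the sequence would grow faster than \<open>q ^ n\<close>.
\<close>

lemma first_ratio_le_of_log_convex:
  fixes a :: "nat \<Rightarrow> real"
  assumes nonneg: "\<And>n. 0 \<le> a n"
    and convex: "\<And>n. (a (Suc n))\<^sup>2 \<le> a n * a (Suc (Suc n))"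
    and bound: "\<And>n. (a (Suc n))\<^sup>2 \<le> C * q ^ (2 * n + 1)"
    and "q > 0"
  shows "a 1 \<le> q * a 0"
proof (rule ccontr)
  assume "\<not> a 1 \<le> q * a 0"
  hence less: "q * a 0 < a 1" by simp
  have "a 0 \<noteq> 0"
    using convex[of 0] less by auto
  hence a0: "a 0 > 0"
    using nonneg[of 0] by simp
  define p where "p = a 1 / a 0"
  have "a 1 > 0"
    using less mult_pos_pos[OF \<open>q > 0\<close> a0] by linarith
  hence p: "p > q" "p > 0"
    using less a0 by (auto simp: p_def field_simps)
  have ratio: "0 < a n \<and> p * a n \<le> a (Suc n)" for n
  proof (induction n)
    case (Suc n)
    hence pos: "0 < a (Suc n)"
      using p by (meson less_le_trans mult_pos_pos)
    have "p * a (Suc n) * a n \<le> a (Suc n) * a (Suc n)"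
      using Suc pos by (simp add: mult.commute mult.left_commute)
    also have "\<dots> \<le> a (Suc (Suc n)) * a n"
      using convex[of n] by (simp add: power2_eq_square mult.commute)
    finally show ?case
      using Suc pos by simp
  qed (use a0 in \<open>simp add: p_def\<close>)
  have growth: "p ^ n * a 0 \<le> a n" for n
  proof (induction n)
    case (Suc n)
    have "p ^ Suc n * a 0 \<le> p * a n"
      using Suc p by (simp add: mult.assoc)
    with ratio[of n] show ?case by linarith
  qed simp
  have "(p / q) ^ (2 * n + 1) \<le> C / (p * (a 0)\<^sup>2)" for n
  proof -
    have "(p ^ Suc n * a 0)\<^sup>2 \<le> C * q ^ (2 * n + 1)"
      using bound[of n] growth[of "Suc n"] p a0
      by (intro order_trans[OF power_mono[OF growth[of "Suc n"]] bound]) simp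
    moreover have "(p ^ Suc n * a 0)\<^sup>2 = p ^ (2 * n + 1) * (p * (a 0)\<^sup>2)"
      by (simp add: power_mult_distrib power2_eq_square power_add mult_2)
    ultimately have "p ^ (2 * n + 1) * (p * (a 0)\<^sup>2) \<le> C * q ^ (2 * n + 1)"
      by argo
    moreover have "P / Y \<le> C / X" if "P * X \<le> C * Y" "X > 0" "Y > 0" for P X Y :: real
      using that by (simp add: field_simps)
    ultimately show ?thesis
      unfolding power_divide using \<open>q > 0\<close> p a0 by simp
  qed
  moreover obtain N where "C / (p * (a 0)\<^sup>2) < (p / q) ^ N"
    using real_arch_pow[of "p / q"] p \<open>q > 0\<close> by auto
  moreover have "(p / q) ^ N \<le> (p / q) ^ (2 * N + 1)"
    using p \<open>q > 0\<close> by (intro power_increasing) auto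
  ultimately show False
    by (meson le_less_trans not_less)
qed

locale self_adjoint =
  fixes D :: "'a :: complex_hilbert set" and M :: "'a \<Rightarrow> 'a"
  assumes self_adjoint: "self_adjoint_op D M"
begin

lemma linear: "linear_op_on D M"
  using self_adjoint by (simp add: self_adjoint_op_def)

lemma subspace_D: "complex_vector.subspace D"
  using linear by (simp add: linear_op_on_def)

lemma M_add: "x \<in> D \<Longrightarrow> y \<in> D \<Longrightarrow> M (x + y) = M x + M y"
  and M_scaleC: "x \<in> D \<Longrightarrow> M (a *\<^sub>C x) = a *\<^sub>C M x"
  using linear by (simp_all add: linear_op_on_def)

lemma D_add: "x \<in> D \<Longrightarrow> y \<in> D \<Longrightarrow> x + y \<in> D"
  and D_scaleC: "x \<in> D \<Longrightarrow> a *\<^sub>C x \<in> D"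
  and D_diff: "x \<in> D \<Longrightarrow> y \<in> D \<Longrightarrow> x - y \<in> D"
  using subspace_D
  by (auto intro: complex_vector.subspace_add complex_vector.subspace_scale
      complex_vector.subspace_diff)

lemma M_diff: "x \<in> D \<Longrightarrow> y \<in> D \<Longrightarrow> M (x - y) = M x - M y"
  using M_add[of "x - y" y] D_diff by simp

lemma symmetric: "x \<in> D \<Longrightarrow> y \<in> D \<Longrightarrow> cinner x (M y) = cinner (M x) y"
  using self_adjoint by (auto simp: self_adjoint_op_def adjoint_graph_def set_eq_iff)

text \<open>
  Self-adjointness turns an identity tested against the domain into membership in the domain.
  In particular limits of eigenvector equations need only be checked weakly.
\<close>

lemma adjoint_memI:
  assumes "\<And>x. x \<in> D \<Longrightarrow> cinner y (M x) = cinner z x"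
  shows "y \<in> D" "M y = z"
proof -
  have "(y, z) \<in> adjoint_graph D M"
    using assms by (simp add: adjoint_graph_def)
  thus "y \<in> D" "M y = z"
    using self_adjoint by (auto simp: self_adjoint_op_def)
qed

abbreviation "res \<equiv> op_resolvent_set D M"

text \<open>
  The resolvent; it is an everywhere defined bounded operator only for \<open>z\<close> in \<open>res\<close>.
\<close>

definition R :: "complex \<Rightarrow> 'a \<Rightarrow> 'a" where
  "R z = inv_into D (\<lambda>x. z *\<^sub>C x - M x)"

lemma R_in: "z \<in> res \<Longrightarrow> R z y \<in> D"
  unfolding R_def op_resolvent_set_def bij_betw_def by (auto intro: inv_into_into)

lemma R_right: "z \<in> res \<Longrightarrow> z *\<^sub>C R z y - M (R z y) = y"
  unfolding R_def op_resolvent_set_def bij_betw_def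
  using f_inv_into_f[of y "\<lambda>x. z *\<^sub>C x - M x" D] by auto

lemma R_eqI: "z \<in> res \<Longrightarrow> x \<in> D \<Longrightarrow> z *\<^sub>C x - M x = y \<Longrightarrow> R z y = x"
  unfolding R_def op_resolvent_set_def bij_betw_def
  using inv_into_f_eq[of "\<lambda>x. z *\<^sub>C x - M x" D x y] by auto

lemma R_bound:
  assumes "z \<in> res"
  obtains K where "K > 0" "\<And>y. norm (R z y) \<le> K * norm y"
proof -
  have "bounded_linear (R z)"
    using assms by (simp add: R_def op_resolvent_set_def)
  from bounded_linear.pos_bounded[OF this] show ?thesis
    using that by (auto simp: mult.commute)
qed

lemma R_add: "z \<in> res \<Longrightarrow> R z (x + y) = R z x + R z y"
  using R_right[of z x] R_right[of z y]
  by (intro R_eqI) (auto simp: R_in D_add M_add scaleC_add_right algebra_simps)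

lemma R_scaleC: "z \<in> res \<Longrightarrow> R z (a *\<^sub>C x) = a *\<^sub>C R z x"
proof (intro R_eqI)
  assume z: "z \<in> res"
  have "z *\<^sub>C (a *\<^sub>C R z x) - M (a *\<^sub>C R z x) = a *\<^sub>C (z *\<^sub>C R z x - M (R z x))"
    using z by (simp add: M_scaleC R_in scaleC_scaleC scaleC.diff_right mult.commute)
  thus "z *\<^sub>C (a *\<^sub>C R z x) - M (a *\<^sub>C R z x) = a *\<^sub>C x"
    using z by (simp add: R_right)
qed (auto simp: R_in D_scaleC)

lemma resolvent_identity:
  assumes "z \<in> res" "w \<in> res"
  shows "R w y = R z y + (z - w) *\<^sub>C R z (R w y)"
proof -
  have "R z (y + (z - w) *\<^sub>C R w y) = R w y"
    using assms R_right[of w y]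
    by (intro R_eqI) (auto simp: R_in scaleC.diff_left algebra_simps)
  thus ?thesis
    using assms by (simp add: R_add R_scaleC)
qed

lemma R_adjoint:
  assumes "z \<in> res" "cnj z \<in> res"
  shows "cinner (R z x) y = cinner x (R (cnj z) y)"
proof -
  define u v where "u = R z x" and "v = R (cnj z) y"
  have x: "x = z *\<^sub>C u - M u" and y: "y = cnj z *\<^sub>C v - M v" and D: "u \<in> D" "v \<in> D"
    using assms by (simp_all add: u_def v_def R_right R_in)
  have "cinner u (cnj z *\<^sub>C v - M v) = cinner (z *\<^sub>C u - M u) v"
    using D by (simp add: cinner.diff_left cinner.diff_right cinner_scaleC_left
        cinner_scaleC_right symmetric)
  hence "cinner u y = cinner x v"
    by (simp only: x[symmetric] y[symmetric])
  thus ?thesis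
    unfolding u_def v_def .
qed

lemma R_pow_add_scaleC:
  "z \<in> res \<Longrightarrow> (R z ^^ n) (x + a *\<^sub>C y) = (R z ^^ n) x + a *\<^sub>C (R z ^^ n) y"
  by (induction n) (simp_all add: R_add R_scaleC)

lemma norm_R_pow_le:
  assumes "\<And>y. norm (R z y) \<le> K * norm y" "K \<ge> 0"
  shows "norm ((R z ^^ n) y) \<le> K ^ n * norm y"
proof (induction n)
  case (Suc n)
  have "norm ((R z ^^ Suc n) y) \<le> K * norm ((R z ^^ n) y)"
    using assms(1) by simp
  also have "\<dots> \<le> K * (K ^ n * norm y)"
    using Suc assms(2) by (intro mult_left_mono)
  finally show ?case by (simp add: mult.assoc)
qed simp

text \<open>
  Iterating the resolvent identity \<open>N\<close> times produces the first \<open>N\<close> terms of the Neumann series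
  and a remainder of size \<open>(cmod (w - z) * K) ^ N\<close>. Assuming \<open>w \<in> res\<close> avoids a separate proof
  that the resolvent set is open.
\<close>

lemma neumann_sums:
  assumes z: "z \<in> res" and w: "w \<in> res"
    and K: "\<And>y. norm (R z y) \<le> K * norm y" "K \<ge> 0"
    and small: "cmod (w - z) * K < 1"
  shows "(\<lambda>n. ((-1) ^ n * cinner x ((R z ^^ Suc n) y)) * (w - z) ^ n) sums cinner x (R w y)"
proof -
  have partial: "cinner x (R w y) =
      (\<Sum>n<N. ((-1) ^ n * cinner x ((R z ^^ Suc n) y)) * (w - z) ^ n) +
      (z - w) ^ N * cinner x ((R z ^^ N) (R w y))" for N
  proof (induction N)
    case (Suc N)
    have "(R z ^^ N) (R w y) = (R z ^^ N) (R z y + (z - w) *\<^sub>C R z (R w y))"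
      using resolvent_identity[OF z w, of y] by simp
    also have "\<dots> = (R z ^^ Suc N) y + (z - w) *\<^sub>C (R z ^^ Suc N) (R w y)"
      by (simp only: R_pow_add_scaleC[OF z] funpow_Suc_right o_apply)
    finally have "cinner x ((R z ^^ N) (R w y)) =
        cinner x ((R z ^^ Suc N) y) + (z - w) * cinner x ((R z ^^ Suc N) (R w y))"
      by (simp only: cinner_add_right cinner_scaleC_right)
    moreover have "(z - w) ^ N = (-1) ^ N * (w - z) ^ N"
      by (simp flip: power_mult_distrib)
    ultimately show ?case
      by (simp only: Suc sum.lessThan_Suc power_Suc) (simp add: algebra_simps)
  qed simp
  have "(\<lambda>N. (z - w) ^ N * cinner x ((R z ^^ N) (R w y))) \<longlonglongrightarrow> 0"
  proof (rule Lim_null_comparison)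
    show "eventually (\<lambda>N. norm ((z - w) ^ N * cinner x ((R z ^^ N) (R w y))) \<le>
        norm x * norm (R w y) * (cmod (w - z) * K) ^ N) sequentially"
    proof (intro always_eventually allI)
      fix N
      have "norm ((z - w) ^ N * cinner x ((R z ^^ N) (R w y))) \<le>
          cmod (z - w) ^ N * (norm x * (K ^ N * norm (R w y)))"
        unfolding norm_mult norm_power
        by (intro mult_left_mono order_trans[OF norm_cinner_le] norm_R_pow_le K) simp_all
      thus "norm ((z - w) ^ N * cinner x ((R z ^^ N) (R w y))) \<le>
          norm x * norm (R w y) * (cmod (w - z) * K) ^ N"
        by (simp add: power_mult_distrib norm_minus_commute mult_ac)
    qed
    have "(\<lambda>N. (cmod (w - z) * K) ^ N) \<longlonglongrightarrow> 0"
      using small K(2) by (intro LIMSEQ_realpow_zero) auto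
    from tendsto_mult_left[OF this, of "norm x * norm (R w y)"]
    show "(\<lambda>N. norm x * norm (R w y) * (cmod (w - z) * K) ^ N) \<longlonglongrightarrow> 0"
      by simp
  qed
  hence "(\<lambda>N. cinner x (R w y) - (z - w) ^ N * cinner x ((R z ^^ N) (R w y)))
      \<longlonglongrightarrow> cinner x (R w y) - 0"
    by (intro tendsto_diff tendsto_const)
  moreover have "(\<lambda>N. cinner x (R w y) - (z - w) ^ N * cinner x ((R z ^^ N) (R w y))) =
      (\<lambda>N. \<Sum>n<N. ((-1) ^ n * cinner x ((R z ^^ Suc n) y)) * (w - z) ^ n)"
    by (rule ext) (simp only: diff_eq_eq flip: partial)
  ultimately show ?thesis
    unfolding sums_def by simp
qed

lemma resolvent_holomorphic:
  assumes "open U" "U \<subseteq> res"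
  shows "(\<lambda>z. cinner x (R z y)) holomorphic_on U"
proof -
  have "\<exists>r>0. (\<lambda>z. cinner x (R z y)) holomorphic_on ball z r" if zU: "z \<in> U" for z
  proof -
    obtain r where r: "r > 0" "ball z r \<subseteq> U"
      using openE[OF assms(1) zU] .
    have z: "z \<in> res"
      using zU assms(2) by blast
    obtain K where K: "K > 0" "\<And>y. norm (R z y) \<le> K * norm y"
      using R_bound[OF z] by blast
    have "(\<lambda>z. cinner x (R z y)) holomorphic_on ball z (min r (1 / K))"
    proof (rule power_series_holomorphic)
      fix w assume w: "w \<in> ball z (min r (1 / K))"
      hence "cmod (w - z) * K < 1"
        using K(1) by (simp add: dist_norm norm_minus_commute field_simps)
      moreover have "w \<in> res"
        using w r assms(2) by auto
      ultimately show "(\<lambda>n. ((-1) ^ n * cinner x ((R z ^^ Suc n) y)) * (w - z) ^ n)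
          sums cinner x (R w y)"
        using K z by (intro neumann_sums) auto
    qed
    thus ?thesis
      using r K by (intro exI[of _ "min r (1 / K)"]) simp
  qed
  hence "(\<lambda>z. cinner x (R z y)) analytic_on U"
    by (simp add: analytic_on_def)
  thus ?thesis
    by (rule analytic_imp_holomorphic)
qed

text \<open>
  A vector-wise form of the fact that a self-adjoint operator has norm equal to its spectral
  radius. The Taylor coefficients of \<open>G\<close> at \<open>t\<close> are, up to sign, \<open>cinner x (A ^ Suc n x)\<close>
  for the symmetric operator \<open>A = R t\<close>. Up to a constant factor, the Cauchy inequalities bound them
  by powers of \<open>1 / \<rho>\<close> for every \<open>\<rho> < r\<close>. By symmetry the odd ones are \<open>(norm (A ^ Suc n x))\<^sup>2\<close>, and these norms are
  log-convex in \<open>n\<close> by Cauchy-Schwarz, so already the first ratio is at most \<open>1 / \<rho>\<close>.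
\<close>

lemma norm_R_le_of_extension:
  assumes t: "t \<in> res" "cnj t = t"
    and r: "r > 0" and G: "G holomorphic_on ball t r"
    and eq: "\<forall>\<^sub>F w in nhds t. w \<in> res \<and> G w = cinner x (R w x)"
  shows "norm (R t x) \<le> norm x / r"
proof -
  define A where "A = R t"
  define c where "c n = (-1) ^ n * cinner x ((A ^^ Suc n) x)" for n
  define H where "H = (\<lambda>u. G (t + u))"
  have sym: "cinner ((A ^^ n) u) v = cinner u ((A ^^ n) v)" for n u v
  proof (induction n arbitrary: u)
    case (Suc n)
    have "cinner ((A ^^ Suc n) u) v = cinner ((A ^^ n) (A u)) v"
      by (simp only: funpow_Suc_right o_apply)
    also have "\<dots> = cinner (A u) ((A ^^ n) v)"
      by (rule Suc)
    also have "\<dots> = cinner u (A ((A ^^ n) v))"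
      unfolding A_def using R_adjoint[of t u] t by simp
    finally show ?case by simp
  qed simp
  have holH: "H holomorphic_on ball 0 r"
  proof -
    have "(G \<circ> (\<lambda>u. t + u)) holomorphic_on ball 0 r"
      by (rule holomorphic_on_compose_gen[OF _ G]) (auto intro!: holomorphic_intros simp: dist_norm)
    thus ?thesis by (simp add: H_def o_def)
  qed
  have coeff: "c n = (deriv ^^ n) H 0 / fact n" for n
  proof -
    obtain K where K: "K > 0" "\<And>y. norm (R t y) \<le> K * norm y"
      using R_bound[OF t(1)] by blast
    obtain s where s: "s > 0" "\<And>w. dist w t < s \<Longrightarrow> w \<in> res \<and> G w = cinner x (R w x)"
      using eq by (auto simp: eventually_nhds_metric)
    have "\<forall>\<^sub>F u in nhds 0. (\<lambda>n. c n * u ^ n) sums H u"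
      unfolding eventually_nhds_metric
    proof (intro exI[of _ "min s (1 / K)"] conjI allI impI)
      fix u :: complex assume u: "dist u 0 < min s (1 / K)"
      have "(\<lambda>n. ((-1) ^ n * cinner x ((R t ^^ Suc n) x)) * ((t + u) - t) ^ n)
          sums cinner x (R (t + u) x)"
        using u s(2)[of "t + u"] K t
        by (intro neumann_sums[where K = K]) (auto simp: dist_norm field_simps)
      thus "(\<lambda>n. c n * u ^ n) sums H u"
        using u s(2)[of "t + u"] by (simp add: c_def H_def A_def dist_norm)
    qed (use s K in auto)
    hence "H has_fps_expansion Abs_fps c"
      by (intro has_fps_expansionI) simp
    from fps_nth_fps_expansion[OF this, of n] show ?thesis by simp
  qed
  have *: "norm (A x) \<le> (1 / \<rho>) * norm x" if \<rho>: "0 < \<rho>" "\<rho> < r" for \<rho>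
  proof -
    have cont: "continuous_on (cball 0 \<rho>) H"
      using \<rho>
      by (intro holomorphic_on_imp_continuous_on holomorphic_on_subset[OF holH]) auto
    hence "bounded (H ` cball 0 \<rho>)"
      by (rule compact_imp_bounded[OF compact_continuous_image[OF _ compact_cball]])
    then obtain B where B: "\<And>u. u \<in> cball 0 \<rho> \<Longrightarrow> cmod (H u) \<le> B"
      unfolding bounded_iff by blast
    have c_le: "cmod (c n) \<le> B * (1 / \<rho>) ^ n" for n
    proof -
      have "norm ((deriv ^^ n) H 0) \<le> fact n * B / \<rho> ^ n"
      proof (rule Cauchy_inequality)
        show "H holomorphic_on ball 0 \<rho>"
          using \<rho> by (intro holomorphic_on_subset[OF holH]) auto
        show "cmod (H u) \<le> B" if "cmod (0 - u) = \<rho>" for u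
          using that by (intro B) simp
      qed (use cont \<rho> in auto)
      thus ?thesis
        unfolding coeff by (simp add: norm_divide power_divide field_simps)
    qed
    define a where "a n = norm ((A ^^ n) x)" for n
    have inner: "(a (Suc n))\<^sup>2 = cmod (cinner ((A ^^ n) x) ((A ^^ Suc (Suc n)) x))"
      "(a (Suc n))\<^sup>2 = cmod (c (2 * n + 1))" for n
    proof -
      have "(a (Suc n))\<^sup>2 = cmod (cinner ((A ^^ Suc n) x) ((A ^^ Suc n) x))"
        by (simp add: a_def cinner_self norm_power)
      also have "cinner ((A ^^ Suc n) x) ((A ^^ Suc n) x) = cinner ((A ^^ n) x) (A ((A ^^ Suc n) x))"
        using sym[of 1 "(A ^^ n) x" "(A ^^ Suc n) x"] by simp
      finally show 1: "(a (Suc n))\<^sup>2 = cmod (cinner ((A ^^ n) x) ((A ^^ Suc (Suc n)) x))"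
        by simp
      also have "cinner ((A ^^ n) x) ((A ^^ Suc (Suc n)) x) = cinner x ((A ^^ (n + Suc (Suc n))) x)"
        by (simp only: sym funpow_add o_apply)
      finally show "(a (Suc n))\<^sup>2 = cmod (c (2 * n + 1))"
        by (simp add: c_def norm_mult norm_power mult_2)
    qed
    have "a 1 \<le> (1 / \<rho>) * a 0"
    proof (rule first_ratio_le_of_log_convex)
      show "(a (Suc n))\<^sup>2 \<le> a n * a (Suc (Suc n))" for n
        unfolding inner(1) by (rule norm_cinner_le[THEN order_trans]) (simp add: a_def)
      show "(a (Suc n))\<^sup>2 \<le> B * (1 / \<rho>) ^ (2 * n + 1)" for n
        unfolding inner(2) by (rule c_le)
    qed (use \<rho> in \<open>simp_all add: a_def\<close>)
    thus ?thesis by (simp add: a_def)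
  qed
  \<comment> \<open>The Cauchy inequalities need a closed disc inside the ball, hence the limit \<open>\<rho> \<rightarrow> r\<close>.\<close>
  have "norm (A x) * r \<le> norm x"
  proof (rule field_le_mult_one_interval)
    fix z :: real assume z: "0 < z" "z < 1"
    show "z * (norm (A x) * r) \<le> norm x"
      using *[of "z * r"] z r by (simp add: field_simps)
  qed
  thus ?thesis
    using r by (simp add: A_def field_simps)
qed

end

locale isolated_point = self_adjoint +
  fixes lam :: complex and \<mu> :: real
  assumes lam_real: "cnj lam = lam" and \<mu>_pos: "\<mu> > 0"
    and punctured_disc: "\<And>z. z \<noteq> lam \<Longrightarrow> cmod (z - lam) < \<mu> \<Longrightarrow> z \<in> op_resolvent_set D M"
begin

text \<open>
  For real \<open>s\<close> with \<open>\<bar>s\<bar> < \<mu> / 2\<close> the open disc of radius \<open>\<bar>s\<bar>\<close> around \<open>lam + s\<close> just touches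
  \<open>lam\<close> and stays in the resolvent set, so no extension is needed.
\<close>

lemma norm_R_le_real:
  fixes s :: real
  assumes "s \<noteq> 0" "\<bar>s\<bar> < \<mu> / 2"
  shows "norm (R (lam + of_real s) x) \<le> norm x / \<bar>s\<bar>"
proof (rule norm_R_le_of_extension)
  have sub: "ball (lam + of_real s) \<bar>s\<bar> \<subseteq> res"
  proof
    fix z assume z: "z \<in> ball (lam + of_real s) \<bar>s\<bar>"
    hence "z \<noteq> lam"
      by (auto simp: dist_norm)
    moreover have "cmod (z - lam) \<le> cmod (z - (lam + of_real s)) + cmod (of_real s)"
      using norm_triangle_ineq[of "z - (lam + of_real s)" "of_real s"] by simp
    hence "cmod (z - lam) < \<mu>"
      using z assms by (simp add: dist_norm norm_minus_commute)
    ultimately show "z \<in> res"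
      by (rule punctured_disc)
  qed
  show "(\<lambda>w. cinner x (R w x)) holomorphic_on ball (lam + of_real s) \<bar>s\<bar>"
    by (rule resolvent_holomorphic[OF open_ball sub])
  show "\<forall>\<^sub>F w in nhds (lam + of_real s). w \<in> res \<and> cinner x (R w x) = cinner x (R w x)"
    using eventually_nhds_in_open[of "ball (lam + of_real s) \<bar>s\<bar>" "lam + of_real s"] sub assms
    by (auto elim!: eventually_mono)
  show "lam + of_real s \<in> res"
    using sub assms by auto
qed (use assms lam_real in auto)

text \<open>
  The imaginary part of \<open>\<zeta>\<close> contributes orthogonally to \<open>norm ((lam + \<zeta> - M) u)\<close> since
  \<open>cinner (M u) u\<close> is real. Thus the bound for complex \<open>\<zeta>\<close> follows from the real one by
  Pythagoras.
\<close>

lemma norm_R_le: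
  assumes "\<zeta> \<noteq> 0" "cmod \<zeta> < \<mu> / 2"
  shows "norm (R (lam + \<zeta>) x) \<le> norm x / cmod \<zeta>"
proof -
  have res: "lam + \<zeta> \<in> res"
    using assms \<mu>_pos by (intro punctured_disc) auto
  define u where "u = R (lam + \<zeta>) x"
  define p where "p = (lam + of_real (Re \<zeta>)) *\<^sub>C u - M u"
  have u: "u \<in> D" and x: "x = (lam + \<zeta>) *\<^sub>C u - M u"
    using res by (simp_all add: u_def R_in R_right)
  have "\<bar>Re \<zeta>\<bar> * norm u \<le> norm p"
  proof (cases "Re \<zeta> = 0")
    case False
    have small: "\<bar>Re \<zeta>\<bar> < \<mu> / 2"
      using abs_Re_le_cmod[of \<zeta>] assms(2) by linarith
    hence "lam + of_real (Re \<zeta>) \<in> res"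
      using False \<mu>_pos by (intro punctured_disc) auto
    hence "R (lam + of_real (Re \<zeta>)) p = u"
      using u by (intro R_eqI) (auto simp: p_def)
    thus ?thesis
      using norm_R_le_real[OF False small, of p] False by (simp add: field_simps)
  qed simp
  moreover have "x = p + (\<i> * of_real (Im \<zeta>)) *\<^sub>C u"
  proof -
    have "lam + \<zeta> = (lam + of_real (Re \<zeta>)) + \<i> * of_real (Im \<zeta>)"
      by (simp add: complex_eq_iff)
    hence "x = ((lam + of_real (Re \<zeta>)) + \<i> * of_real (Im \<zeta>)) *\<^sub>C u - M u"
      using x by argo
    thus ?thesis
      by (simp add: p_def scaleC_add_left)
  qed
  moreover have "Re (cinner p ((\<i> * of_real (Im \<zeta>)) *\<^sub>C u)) = 0"
  proof -
    have "cnj (cinner p u) = cinner p u"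
      using u lam_real cinner_commute[of u "M u"] cinner_commute[of u u] symmetric[of u u]
      by (simp add: p_def cinner.diff_left cinner_scaleC_left)
    hence "Im (cinner p u) = 0"
      using Reals_cnj_iff complex_is_Real_iff by metis
    thus ?thesis
      by (simp add: cinner_scaleC_right)
  qed
  ultimately have "(norm x)\<^sup>2 = (norm p)\<^sup>2 + (\<bar>Im \<zeta>\<bar> * norm u)\<^sup>2"
    "(\<bar>Re \<zeta>\<bar> * norm u)\<^sup>2 \<le> (norm p)\<^sup>2"
    by (simp_all add: norm_add_square norm_scaleC norm_mult power_mono)
  hence "(cmod \<zeta> * norm u)\<^sup>2 \<le> (norm x)\<^sup>2"
    by (simp add: power_mult_distrib cmod_power2 algebra_simps)
  hence "cmod \<zeta> * norm u \<le> norm x"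
    by (rule power2_le_imp_le) simp
  thus ?thesis
    using assms by (simp add: u_def field_simps)
qed

lemma shifted_in_res: "0 < \<bar>s\<bar> \<Longrightarrow> \<bar>s\<bar> < \<mu> \<Longrightarrow> lam + of_real s \<in> res"
  by (intro punctured_disc) auto

text \<open>
  These two identities reflect that \<open>R\<close> commutes with \<open>M - lam\<close>. The first shows that the
  resolvent stays bounded near \<open>lam\<close> on the range of \<open>M - lam\<close>; the second shows that it maps
  this range into itself.
\<close>

lemma R_range:
  assumes "lam + \<zeta> \<in> res" "x \<in> D"
  shows "R (lam + \<zeta>) (M x - lam *\<^sub>C x) = \<zeta> *\<^sub>C R (lam + \<zeta>) x - x"
    "M (R (lam + \<zeta>) x) - lam *\<^sub>C R (lam + \<zeta>) x = R (lam + \<zeta>) (M x - lam *\<^sub>C x)"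
proof -
  define u where "u = R (lam + \<zeta>) x"
  have u: "u \<in> D" "(lam + \<zeta>) *\<^sub>C u - M u = x"
    using assms by (simp_all add: u_def R_in R_right)
  have Mu: "M u = (lam + \<zeta>) *\<^sub>C u - x"
    using u(2) by (simp add: algebra_simps)
  show 1: "R (lam + \<zeta>) (M x - lam *\<^sub>C x) = \<zeta> *\<^sub>C u - x"
  proof (intro R_eqI)
    have "M (\<zeta> *\<^sub>C u - x) = \<zeta> *\<^sub>C ((lam + \<zeta>) *\<^sub>C u - x) - M x"
      using u(1) assms(2) by (simp add: M_diff M_scaleC D_scaleC Mu)
    thus "(lam + \<zeta>) *\<^sub>C (\<zeta> *\<^sub>C u - x) - M (\<zeta> *\<^sub>C u - x) = M x - lam *\<^sub>C x"
      by (simp add: scaleC.diff_right scaleC_add_left scaleC_scaleC algebra_simps)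
  qed (use assms u in \<open>auto intro: D_diff D_scaleC\<close>)
  show "M u - lam *\<^sub>C u = R (lam + \<zeta>) (M x - lam *\<^sub>C x)"
    unfolding 1 by (simp add: Mu scaleC_add_left)
qed

text \<open>
  For \<open>y\<close> in the range of \<open>M - lam\<close> the function \<open>cinner y (R z y)\<close> is bounded near \<open>lam\<close>. Riemann's
  theorem extends it to the full disc of radius \<open>\<mu>\<close>, which contains the disc of radius
  \<open>\<mu> - \<bar>s\<bar>\<close> around \<open>lam + s\<close>.
\<close>

lemma norm_R_range_le:
  fixes s :: real
  assumes x: "x \<in> D" and s: "0 < \<bar>s\<bar>" "\<bar>s\<bar> < \<mu>"
  defines "y \<equiv> M x - lam *\<^sub>C x"
  shows "norm (R (lam + of_real s) y) \<le> norm y / (\<mu> - \<bar>s\<bar>)"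
proof -
  have sub: "ball lam \<mu> - {lam} \<subseteq> res"
    by (intro subsetI punctured_disc) (auto simp: dist_norm norm_minus_commute)
  have hol: "(\<lambda>z. cinner y (R z y)) holomorphic_on ball lam \<mu> - {lam}"
    by (intro resolvent_holomorphic sub open_delete open_ball)
  have bound: "cmod (cinner y (R z y)) \<le> norm y * (2 * norm x)"
    if z: "z \<noteq> lam" "cmod (z - lam) < \<mu> / 2" for z
  proof -
    have res: "z \<in> res"
      using z \<mu>_pos by (intro punctured_disc) auto
    have "norm (R z y) = norm ((z - lam) *\<^sub>C R z x - x)"
      using R_range(1)[of "z - lam" x] res x by (simp add: y_def)
    also have "\<dots> \<le> cmod (z - lam) * norm (R z x) + norm x"
      using norm_triangle_ineq4[of "(z - lam) *\<^sub>C R z x" x] by (simp add: norm_scaleC)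
    finally have "norm (R z y) \<le> cmod (z - lam) * norm (R z x) + norm x" .
    moreover have "cmod (z - lam) * norm (R z x) \<le> norm x"
      using norm_R_le[of "z - lam" x] z by (simp add: field_simps)
    ultimately have "norm (R z y) \<le> 2 * norm x" by simp
    thus ?thesis
      by (intro order_trans[OF norm_cinner_le] mult_left_mono) simp_all
  qed
  have "\<exists>B. \<forall>\<^sub>F z in at lam. cmod (cinner y (R z y)) \<le> B"
    unfolding eventually_at
    by (rule exI[of _ "norm y * (2 * norm x)"], rule exI[of _ "\<mu> / 2"])
       (use bound \<mu>_pos in \<open>auto simp: dist_norm\<close>)
  then obtain g where g: "g holomorphic_on ball lam \<mu>"
    "\<And>z. z \<in> ball lam \<mu> - {lam} \<Longrightarrow> g z = cinner y (R z y)"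
    using holomorphic_on_extend_bounded[OF hol] \<mu>_pos by auto
  show ?thesis
  proof (rule norm_R_le_of_extension)
    have "ball (lam + of_real s) (\<mu> - \<bar>s\<bar>) \<subseteq> ball lam \<mu>"
      using s by (simp add: ball_subset_ball_iff dist_norm)
    thus "g holomorphic_on ball (lam + of_real s) (\<mu> - \<bar>s\<bar>)"
      using g(1) holomorphic_on_subset by blast
    have "lam + of_real s \<in> ball lam \<mu> - {lam}"
      using s by (auto simp: dist_norm)
    moreover have "open (ball lam \<mu> - {lam})"
      by (intro open_delete open_ball)
    ultimately have "\<forall>\<^sub>F w in nhds (lam + of_real s). w \<in> ball lam \<mu> - {lam}"
      using eventually_nhds_in_open by blast
    thus "\<forall>\<^sub>F w in nhds (lam + of_real s). w \<in> res \<and> g w = cinner y (R w y)"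
      by eventually_elim (use sub g(2) in auto)
  qed (use s shifted_in_res lam_real in auto)
qed

text \<open>
  With \<open>y = M x - lam x\<close>, let \<open>u\<close> be the resolvent at a real point \<open>t\<close> applied to \<open>y\<close>. Its norm
  is at most \<open>norm y / (\<mu> - \<bar>t - lam\<bar>)\<close>. As \<open>t\<close> tends to \<open>lam\<close>, these vectors form a Cauchy
  sequence, because \<open>u\<close> lies again in the range of \<open>M - lam\<close> and the resolvent identity applies
  with the same bound. The limit \<open>v\<close> satisfies \<open>(M - lam) v = - y\<close>, so \<open>v + x\<close> is in the
  eigenspace. It is also orthogonal to the eigenspace, hence \<open>v = - x\<close>, and the norm bound passes
  to the limit.
\<close>

theorem spectral_gap:
  assumes x: "x \<in> D"
    and orth: "\<And>e. e \<in> op_eigenspace D M lam \<Longrightarrow> cinner e x = 0"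
  shows "\<mu> * norm x \<le> norm (M x - lam *\<^sub>C x)"
proof -
  define y where "y = M x - lam *\<^sub>C x"
  define s where "s n = \<mu> / real (n + 2)" for n
  define t where "t n = lam + of_real (s n)" for n
  define u where "u n = R (t n) y" for n
  have s: "0 < \<bar>s n\<bar>" "0 < s n" "s n \<le> \<mu> / 2" "\<bar>s n\<bar> < \<mu>" for n
  proof -
    show pos: "0 < s n"
      unfolding s_def using \<mu>_pos by (intro divide_pos_pos) auto
    show le: "s n \<le> \<mu> / 2"
      unfolding s_def using \<mu>_pos by (intro divide_left_mono) auto
    show "0 < \<bar>s n\<bar>" "\<bar>s n\<bar> < \<mu>"
      using pos le \<mu>_pos by auto
  qed
  have t_res: "t n \<in> res" for n
    unfolding t_def using s by (intro shifted_in_res)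
  have s_lim: "s \<longlonglongrightarrow> 0"
    unfolding s_def by (intro tendsto_divide_0[OF tendsto_const] filterlim_at_top_imp_at_infinity
        filterlim_compose[OF filterlim_real_sequentially] filterlim_add_const_nat_at_top)
  have t_lim: "t \<longlonglongrightarrow> lam"
    unfolding t_def using tendsto_add[OF tendsto_const tendsto_of_real[OF s_lim]] by simp
  have bound: "norm (R (t n) (M v - lam *\<^sub>C v)) \<le> (2 / \<mu>) * norm (M v - lam *\<^sub>C v)"
    if "v \<in> D" for n v
  proof -
    have "norm (R (t n) (M v - lam *\<^sub>C v)) \<le> norm (M v - lam *\<^sub>C v) / (\<mu> - \<bar>s n\<bar>)"
      unfolding t_def using that s by (intro norm_R_range_le)
    also have "\<dots> \<le> norm (M v - lam *\<^sub>C v) / (\<mu> / 2)"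
      using s(2,3)[of n] \<mu>_pos by (intro divide_left_mono) auto
    finally show ?thesis by (simp add: mult.commute)
  qed
  have diff: "dist (u m) (u n) \<le> (2 / \<mu>)\<^sup>2 * norm y * dist (s m) (s n)" for m n
  proof -
    have um: "u m = M (R (t m) x) - lam *\<^sub>C R (t m) x"
      using R_range(2)[OF _ x, of "of_real (s m)"] t_res[of m] by (simp add: u_def y_def t_def)
    have "u m - u n = (t n - t m) *\<^sub>C R (t n) (u m)"
      using resolvent_identity[OF t_res t_res, of m y n] unfolding u_def
      by (metis add_diff_cancel_left')
    hence eq: "dist (u m) (u n) = dist (s m) (s n) * norm (R (t n) (u m))"
      by (simp add: dist_norm norm_scaleC t_def abs_minus_commute flip: of_real_diff)
    have "norm (R (t n) (u m)) \<le> (2 / \<mu>) * norm (u m)"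
      unfolding um using t_res by (intro bound R_in)
    moreover have "(2 / \<mu>) * norm (u m) \<le> (2 / \<mu>) * ((2 / \<mu>) * norm y)"
      unfolding u_def y_def using x \<mu>_pos by (intro mult_left_mono bound) auto
    ultimately have "norm (R (t n) (u m)) \<le> (2 / \<mu>)\<^sup>2 * norm y"
      by (simp add: power2_eq_square mult.assoc)
    from mult_left_mono[OF this zero_le_dist[of "s m" "s n"]] show ?thesis
      unfolding eq by (simp add: mult_ac)
  qed
  have "Cauchy u"
  proof (rule metric_CauchyI)
    fix e :: real assume "e > 0"
    define C where "C = (2 / \<mu>)\<^sup>2 * norm y + 1"
    have "C > 0"
      by (auto simp: C_def intro: add_nonneg_pos)
    obtain N where N: "\<And>m n. m \<ge> N \<Longrightarrow> n \<ge> N \<Longrightarrow> dist (s m) (s n) < e / C"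
      using LIMSEQ_imp_Cauchy[OF s_lim] \<open>e > 0\<close> \<open>C > 0\<close> unfolding Cauchy_def
      by (meson divide_pos_pos)
    have "dist (u m) (u n) < e" if "m \<ge> N" "n \<ge> N" for m n
    proof -
      have "dist (u m) (u n) \<le> C * dist (s m) (s n)"
        by (rule order_trans[OF diff]) (auto simp: C_def intro: mult_right_mono)
      also have "\<dots> < e"
        using N[OF that] \<open>C > 0\<close> by (simp add: field_simps)
      finally show ?thesis .
    qed
    thus "\<exists>N. \<forall>m\<ge>N. \<forall>n\<ge>N. dist (u m) (u n) < e" by blast
  qed
  then obtain v where v: "u \<longlonglongrightarrow> v"
    using Cauchy_convergent convergent_def by blast
  have orth_u: "cinner e (u n) = 0" if e: "e \<in> op_eigenspace D M lam" for e n
  proof -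
    have eD: "e \<in> D" "M e = lam *\<^sub>C e"
      using e by (auto simp: op_eigenspace_def)
    have "R (t n) (of_real (s n) *\<^sub>C e) = e"
      using eD t_res by (intro R_eqI) (auto simp: t_def scaleC_add_left)
    hence "of_real (s n) *\<^sub>C R (t n) e = e"
      using t_res by (simp add: R_scaleC)
    hence "cinner e x = of_real (s n) * cinner (R (t n) e) x"
      using cinner_scaleC_left[of "of_real (s n)" "R (t n) e" x] by simp
    hence "cinner (R (t n) e) x = 0"
      using orth[OF e] s(1)[of n] by auto
    moreover have "cnj (t n) = t n"
      using lam_real by (simp add: t_def)
    ultimately have "cinner e (R (t n) x) = 0"
      using R_adjoint[of "t n" e x] t_res[of n] by simp
    moreover have "u n = of_real (s n) *\<^sub>C R (t n) x - x"
      using R_range(1)[OF _ x, of "of_real (s n)"] t_res[of n] by (simp add: u_def y_def t_def)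
    ultimately show ?thesis
      using orth[OF e] by (simp add: cinner.diff_right cinner_scaleC_right)
  qed
  have weak: "cinner (v + x) (M w) = cinner (lam *\<^sub>C (v + x)) w" if w: "w \<in> D" for w
  proof -
    have "(\<lambda>n. cinner (u n + x) (M w)) \<longlonglongrightarrow> cinner (v + x) (M w)"
      by (intro cinner.tendsto tendsto_intros v)
    moreover have "cinner (u n + x) (M w) = cinner (t n *\<^sub>C u n + lam *\<^sub>C x) w" for n
    proof -
      have un: "u n \<in> D" "t n *\<^sub>C u n - M (u n) = y"
        using t_res by (simp_all add: u_def R_in R_right)
      have "cinner (u n + x) (M w) = cinner (M (u n + x)) w"
        using un x w by (intro symmetric D_add)
      also have "M (u n + x) = t n *\<^sub>C u n + lam *\<^sub>C x"
        using un x by (simp add: M_add y_def algebra_simps)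
      finally show ?thesis .
    qed
    moreover have "(\<lambda>n. cinner (t n *\<^sub>C u n + lam *\<^sub>C x) w) \<longlonglongrightarrow>
        cinner (lam *\<^sub>C v + lam *\<^sub>C x) w"
      by (intro cinner.tendsto scaleC.tendsto tendsto_intros v t_lim)
    ultimately have "cinner (v + x) (M w) = cinner (lam *\<^sub>C v + lam *\<^sub>C x) w"
      using LIMSEQ_unique by simp
    thus ?thesis
      by (simp add: scaleC_add_right)
  qed
  have in_E: "v + x \<in> op_eigenspace D M lam"
    using adjoint_memI[OF weak] by (simp add: op_eigenspace_def)
  have "(\<lambda>n. cinner (v + x) (u n)) \<longlonglongrightarrow> cinner (v + x) v"
    by (intro cinner.tendsto tendsto_intros v)
  hence "(\<lambda>n. 0) \<longlonglongrightarrow> cinner (v + x) v"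
    using orth_u[OF in_E] by simp
  from LIMSEQ_unique[OF this tendsto_const] have "cinner (v + x) v = 0" .
  hence "cinner (v + x) (v + x) = 0"
    using orth[OF in_E] by (simp add: cinner_add_right)
  hence v_eq: "norm v = norm x"
    by (simp add: cinner_self add_eq_0_iff2)
  have "(\<lambda>n. norm (u n)) \<longlonglongrightarrow> norm x"
    using tendsto_norm[OF v] v_eq by simp
  moreover have "(\<lambda>n. norm y / (\<mu> - s n)) \<longlonglongrightarrow> norm y / (\<mu> - 0)"
    using \<mu>_pos s_lim by (intro tendsto_intros) auto
  moreover have "norm (u n) \<le> norm y / (\<mu> - s n)" for n
    using norm_R_range_le[OF x s(1,4)[of n]] s(2)[of n] by (simp add: u_def y_def t_def)
  ultimately have "norm x \<le> norm y / (\<mu> - 0)"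
    by (intro LIMSEQ_le) auto
  thus ?thesis
    using \<mu>_pos by (simp add: y_def field_simps)
qed

end

section \<open>Determinants of operator-valued functions\<close>

text \<open>
  The Leibniz formula shows that determinants inherit holomorphy and continuity from the matrix
  entries.
\<close>

lemma det_mat_expand:
  "Determinant.det (Matrix.mat n n (\<lambda>(i, j). f i j)) =
    (\<Sum>p | p permutes {0..<n}. signof p * (\<Prod>i = 0..<n. f i (p i)))"
proof -
  have "(\<Prod>i = 0..<n. Matrix.mat n n (\<lambda>(i, j). f i j) $$ (i, p i)) = (\<Prod>i = 0..<n. f i (p i))"
    if "p permutes {0..<n}" for p
  proof (intro prod.cong refl)
    fix i assume "i \<in> {0..<n}"
    moreover from this have "p i < n"
      using permutes_in_image[OF that, of i] by simp
    ultimately show "Matrix.mat n n (\<lambda>(i, j). f i j) $$ (i, p i) = f i (p i)"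
      by simp
  qed
  thus ?thesis
    by (subst det_def'[where n = n]) auto
qed

lemma det_mat_holomorphic:
  assumes "\<And>i j. i < n \<Longrightarrow> j < n \<Longrightarrow> (\<lambda>z. f z i j) holomorphic_on S"
  shows "(\<lambda>z. Determinant.det (Matrix.mat n n (\<lambda>(i, j). f z i j))) holomorphic_on S"
  unfolding det_mat_expand
proof (intro holomorphic_on_sum holomorphic_on_mult holomorphic_on_const holomorphic_on_prod)
  fix p i assume "p \<in> {p. p permutes {0..<n}}" "i \<in> {0..<n}"
  thus "(\<lambda>z. f z i (p i)) holomorphic_on S"
    using permutes_in_image[of p "{0..<n}" i] by (intro assms) auto
qed

lemma det_mat_continuous:
  fixes f :: "'b :: topological_space \<Rightarrow> nat \<Rightarrow> nat \<Rightarrow> complex"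
  assumes "\<And>i j. i < n \<Longrightarrow> j < n \<Longrightarrow> continuous_on S (\<lambda>z. f z i j)"
  shows "continuous_on S (\<lambda>z. Determinant.det (Matrix.mat n n (\<lambda>(i, j). f z i j)))"
  unfolding det_mat_expand
proof (intro continuous_on_sum continuous_on_mult continuous_on_const continuous_on_prod)
  fix p i assume "p \<in> {p. p permutes {0..<n}}" "i \<in> {0..<n}"
  thus "continuous_on S (\<lambda>z. f z i (p i))"
    using permutes_in_image[of p "{0..<n}" i] by (intro assms) auto
qed

abbreviation chosen_basis :: "'a :: complex_hilbert set \<Rightarrow> 'a list" where
  "chosen_basis L \<equiv> SOME b. orthonormal_basis L b"

lemma chosen_basis: "finite_dim L \<Longrightarrow> orthonormal_basis L (chosen_basis L)"
  using ex_orthonormal_basis[of L] by (metis someI_ex)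

context
  fixes L :: "'a :: complex_hilbert set"
  assumes fin: "finite_dim L"
begin

lemma det_on_holomorphic:
  assumes "\<And>x y. x \<in> L \<Longrightarrow> y \<in> L \<Longrightarrow> (\<lambda>z. cinner x (P z y)) holomorphic_on S"
  shows "(\<lambda>z. det_on L (P z)) holomorphic_on S"
  unfolding det_on_def matrix_of_def
  using onb_nth_in[OF chosen_basis[OF fin]] by (intro det_mat_holomorphic assms) auto

lemma det_on_continuous:
  fixes P :: "'b :: topological_space \<Rightarrow> 'a \<Rightarrow> 'a"
  assumes "\<And>x y. x \<in> L \<Longrightarrow> y \<in> L \<Longrightarrow> continuous_on S (\<lambda>z. cinner x (P z y))"
  shows "continuous_on S (\<lambda>z. det_on L (P z))"
  unfolding det_on_def matrix_of_def
  using onb_nth_in[OF chosen_basis[OF fin]] by (intro det_mat_continuous assms) auto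

lemma matrix_of_mult_vec:
  assumes "orthonormal_basis L b" "linear_op_on L T" "i < length b"
  shows "vec_index (matrix_of b T *\<^sub>v Matrix.vec (length b) c) i =
    cinner (b ! i) (T (\<Sum>j<length b. c j *\<^sub>C b ! j))"
  unfolding linear_onb_sum[OF assms(1,2)] cinner.sum_right cinner_scaleC_right
  using assms(3)
  by (simp add: matrix_of_def scalar_prod_def atLeast0LessThan mult.commute)

lemma det_on_eq_0_iff:
  assumes T: "linear_op_on L T" "T ` L \<subseteq> L"
  shows "det_on L T = 0 \<longleftrightarrow> (\<exists>v\<in>L. v \<noteq> 0 \<and> T v = 0)"
proof -
  define b where "b = chosen_basis L"
  define n where "n = length b"
  have b: "orthonormal_basis L b"
    unfolding b_def by (rule chosen_basis[OF fin])
  define vec_sum where "vec_sum c = (\<Sum>j<n. c j *\<^sub>C b ! j)" for c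
  have A: "matrix_of b T \<in> carrier_mat n n"
    by (simp add: matrix_of_def n_def)
  have in_L: "vec_sum c \<in> L" for c
    unfolding vec_sum_def n_def by (rule onb_sum_in[OF b])
  have coord: "cinner (b ! i) (vec_sum c) = c i" if "i < n" for c i
    using that cinner_nth_onb_sum[OF b] by (simp add: vec_sum_def n_def)
  have ker: "matrix_of b T *\<^sub>v Matrix.vec n c = 0\<^sub>v n \<longleftrightarrow> T (vec_sum c) = 0" for c
  proof -
    have "matrix_of b T *\<^sub>v Matrix.vec n c = 0\<^sub>v n \<longleftrightarrow>
        (\<forall>i<n. cinner (b ! i) (T (vec_sum c)) = 0)"
      using A matrix_of_mult_vec[OF b T(1), of _ c]
      by (auto simp: vec_eq_iff n_def vec_sum_def simp del: index_mult_mat_vec)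
    also have "\<dots> \<longleftrightarrow> T (vec_sum c) = 0"
      using onb_eq_0[OF b, of "T (vec_sum c)"] in_L[of c] T(2) by (auto simp: n_def cinner.zero_right)
    finally show ?thesis .
  qed
  have zero: "Matrix.vec n c = 0\<^sub>v n \<longleftrightarrow> vec_sum c = 0" for c
  proof
    assume "Matrix.vec n c = 0\<^sub>v n"
    thus "vec_sum c = 0" by (simp add: vec_sum_def vec_eq_iff)
  next
    assume "vec_sum c = 0"
    thus "Matrix.vec n c = 0\<^sub>v n"
      using coord[of _ c] by (auto simp: vec_eq_iff cinner.zero_right)
  qed
  have "det_on L T = 0 \<longleftrightarrow>
      (\<exists>v. v \<in> carrier_vec n \<and> v \<noteq> 0\<^sub>v n \<and> matrix_of b T *\<^sub>v v = 0\<^sub>v n)"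
    unfolding det_on_def b_def[symmetric] by (rule det_0_iff_vec_prod_zero[OF A])
  also have "\<dots> \<longleftrightarrow> (\<exists>c. Matrix.vec n c \<noteq> 0\<^sub>v n \<and> matrix_of b T *\<^sub>v Matrix.vec n c = 0\<^sub>v n)"
    by (metis carrier_vecD eq_vecI dim_vec index_vec vec_carrier)
  also have "\<dots> \<longleftrightarrow> (\<exists>c. vec_sum c \<noteq> 0 \<and> T (vec_sum c) = 0)"
    by (simp only: ker zero)
  also have "\<dots> \<longleftrightarrow> (\<exists>v\<in>L. v \<noteq> 0 \<and> T v = 0)"
    using in_L onb_expansion[OF b] unfolding vec_sum_def n_def by metis
  finally show ?thesis .
qed

text \<open>
  By Cramer's rule the solution is the adjugate applied to the right-hand side, divided by
  the determinant; all ingredients are polynomials in the matrix entries.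
\<close>

lemma holomorphic_solution:
  assumes lin: "\<And>z. z \<in> S \<Longrightarrow> linear_op_on L (P z)" "\<And>z. z \<in> S \<Longrightarrow> P z ` L \<subseteq> L"
    and hol: "\<And>x y. x \<in> L \<Longrightarrow> y \<in> L \<Longrightarrow> (\<lambda>z. cinner x (P z y)) holomorphic_on S"
    and det: "\<And>z. z \<in> S \<Longrightarrow> det_on L (P z) \<noteq> 0"
    and y: "y \<in> L"
  shows "\<exists>U. (\<forall>z\<in>S. U z \<in> L \<and> P z (U z) = y) \<and> (\<forall>x. (\<lambda>z. cinner x (U z)) holomorphic_on S)"
proof -
  define b where "b = chosen_basis L"
  define n where "n = length b"
  have b: "orthonormal_basis L b"
    unfolding b_def by (rule chosen_basis[OF fin])
  define A where "A z = matrix_of b (P z)" for z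
  have A: "A z \<in> carrier_mat n n" for z
    by (simp add: A_def matrix_of_def n_def)
  have det_A: "Determinant.det (A z) = det_on L (P z)" for z
    by (simp add: A_def det_on_def b_def)
  define Y where "Y = Matrix.vec n (\<lambda>i. cinner (b ! i) y)"
  define c where "c z j = vec_index (adj_mat (A z) *\<^sub>v Y) j / Determinant.det (A z)" for z j
  define U where "U z = (\<Sum>j<n. c z j *\<^sub>C b ! j)" for z
  have c_hol: "(\<lambda>z. c z j) holomorphic_on S" if j: "j < n" for j
  proof -
    have entry: "(\<lambda>z. cinner (b ! i) (P z (b ! k))) holomorphic_on S" if "i < n" "k < n" for i k
      using that onb_nth_in[OF b] by (intro hol) (auto simp: n_def)
    have cof: "(\<lambda>z. cofactor (A z) i j) holomorphic_on S" if i: "i < n" for i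
    proof -
      have del: "mat_delete (A z) i j = Matrix.mat (n - 1) (n - 1) (\<lambda>(i', j').
          cinner (b ! (if i' < i then i' else Suc i')) (P z (b ! (if j' < j then j' else Suc j'))))" for z
        by (rule eq_matI) (use i j in \<open>auto simp: mat_delete_def A_def matrix_of_def n_def\<close>)
      have "(\<lambda>z. Determinant.det (mat_delete (A z) i j)) holomorphic_on S"
        unfolding del by (intro det_mat_holomorphic entry) auto
      thus ?thesis
        unfolding cofactor_def by (intro holomorphic_intros)
    qed
    have "vec_index (adj_mat (A z) *\<^sub>v Y) j = (\<Sum>i<n. cofactor (A z) i j * cinner (b ! i) y)" for z
      using j A[of z]
      by (simp add: adj_mat_def Y_def scalar_prod_def atLeast0LessThan)
    moreover have "(\<lambda>z. Determinant.det (A z)) holomorphic_on S"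
      unfolding det_A by (intro det_on_holomorphic hol)
    ultimately show ?thesis
      unfolding c_def using cof det by (auto intro!: holomorphic_intros simp: det_A)
  qed
  have U_in: "U z \<in> L" for z
    unfolding U_def n_def by (rule onb_sum_in[OF b])
  have solves: "P z (U z) = y" if z: "z \<in> S" for z
  proof -
    have "Matrix.vec n (c z) = (1 / Determinant.det (A z)) \<cdot>\<^sub>v (adj_mat (A z) *\<^sub>v Y)"
      using adj_mat(1)[OF A[of z]] by (auto simp: c_def vec_eq_iff)
    hence "A z *\<^sub>v Matrix.vec n (c z) = (1 / Determinant.det (A z)) \<cdot>\<^sub>v (A z *\<^sub>v (adj_mat (A z) *\<^sub>v Y))"
      using mult_mat_vec[OF A[of z], of "adj_mat (A z) *\<^sub>v Y"] adj_mat(1)[OF A[of z]]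
      by (simp add: Y_def)
    also have "A z *\<^sub>v (adj_mat (A z) *\<^sub>v Y) = (A z * adj_mat (A z)) *\<^sub>v Y"
      using assoc_mult_mat_vec[OF A adj_mat(1)[OF A[of z]], of Y] by (simp add: Y_def)
    also have "\<dots> = Determinant.det (A z) \<cdot>\<^sub>v Y"
      unfolding adj_mat(2)[OF A] by (auto simp: Y_def vec_eq_iff)
    also have "(1 / Determinant.det (A z)) \<cdot>\<^sub>v (Determinant.det (A z) \<cdot>\<^sub>v Y) = Y"
      using det[OF z] by (auto simp: vec_eq_iff det_A)
    finally have AY: "A z *\<^sub>v Matrix.vec n (c z) = Y" .
    have "cinner (b ! i) (P z (U z) - y) = 0" if "i < length b" for i
      using matrix_of_mult_vec[OF b lin(1)[OF z] that, of "c z"] AY that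
      by (simp add: A_def n_def U_def Y_def cinner.diff_right)
    moreover have "P z (U z) - y \<in> L"
      using lin(2)[OF z] U_in y onb_subspace[OF b] by (intro complex_vector.subspace_diff) auto
    ultimately show ?thesis
      using onb_eq_0[OF b] by fastforce
  qed
  have "(\<lambda>z. cinner x (U z)) holomorphic_on S" for x
    unfolding U_def cinner.sum_right cinner_scaleC_right
    by (intro holomorphic_intros c_hol) auto
  with U_in solves show ?thesis
    by (intro exI[of _ U]) simp
qed

text \<open>
  If the pencil were invertible on the whole disc, the maximum principle would carry the
  bound for its inverse from the circle to the centre, where the inverse is too large.
\<close>

lemma det_on_has_zero:
  assumes lin: "\<And>z. linear_op_on L (P z)" "\<And>z. P z ` L \<subseteq> L"
    and hol: "\<And>x y. x \<in> L \<Longrightarrow> y \<in> L \<Longrightarrow> (\<lambda>z. cinner x (P z y)) holomorphic_on UNIV"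
    and "r > 0" "c > 0"
    and bound: "\<And>z v. cmod (z - z0) = r \<Longrightarrow> v \<in> L \<Longrightarrow> c * norm v \<le> norm (P z v)"
    and x: "x \<in> L" "norm (P z0 x) < c * norm x"
  shows "\<exists>z. cmod (z - z0) < r \<and> det_on L (P z) = 0"
proof (rule ccontr)
  assume no_zero: "\<not> ?thesis"
  define y where "y = P z0 x"
  have y: "y \<in> L"
    using lin(2) x(1) by (auto simp: y_def)
  have nz: "det_on L (P z) \<noteq> 0" if z: "z \<in> cball z0 r" for z
  proof (cases "cmod (z - z0) = r")
    case True
    have "v = 0" if "v \<in> L" "P z v = 0" for v
      using bound[OF True that(1)] that(2) \<open>c > 0\<close> by (simp add: mult_le_0_iff)
    thus ?thesis
      using det_on_eq_0_iff[OF lin] by blast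
  next
    case False
    thus ?thesis
      using z no_zero by (auto simp: dist_norm norm_minus_commute)
  qed
  have hol_disc: "(\<lambda>z. cinner u (P z v)) holomorphic_on cball z0 r" if "u \<in> L" "v \<in> L" for u v
    using hol[OF that] by (rule holomorphic_on_subset) simp
  have "\<exists>U. (\<forall>z\<in>cball z0 r. U z \<in> L \<and> P z (U z) = y) \<and>
      (\<forall>u. (\<lambda>z. cinner u (U z)) holomorphic_on cball z0 r)"
    by (rule holomorphic_solution[of "cball z0 r" P y, OF lin hol_disc nz y])
  then obtain U where U: "\<And>z. z \<in> cball z0 r \<Longrightarrow> U z \<in> L" "\<And>z. z \<in> cball z0 r \<Longrightarrow> P z (U z) = y"
    and U_hol: "(\<lambda>z. cinner x (U z)) holomorphic_on cball z0 r"
    by blast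
  have "cmod (cinner x (U z0)) \<le> norm x * (norm y / c)"
  proof (rule maximum_modulus_frontier[where S = "cball z0 r" and f = "\<lambda>z. cinner x (U z)" and \<xi> = z0])
    show "(\<lambda>z. cinner x (U z)) holomorphic_on interior (cball z0 r)"
      using U_hol by (rule holomorphic_on_subset) (rule interior_subset)
    show "continuous_on (closure (cball z0 r)) (\<lambda>z. cinner x (U z))"
      using holomorphic_on_imp_continuous_on[OF U_hol] by simp
    fix z assume "z \<in> frontier (cball z0 r)"
    hence z: "cmod (z - z0) = r" "z \<in> cball z0 r"
      by (auto simp: dist_norm norm_minus_commute)
    have "c * norm (U z) \<le> norm y"
      using bound[OF z(1) U(1)[OF z(2)]] U(2)[OF z(2)] by simp
    hence "norm (U z) \<le> norm y / c"
      using \<open>c > 0\<close> by (simp add: field_simps)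
    thus "cmod (cinner x (U z)) \<le> norm x * (norm y / c)"
      by (intro order_trans[OF norm_cinner_le] mult_left_mono) auto
  qed (use \<open>r > 0\<close> in auto)
  moreover have "U z0 = x"
  proof (rule ccontr)
    assume neq: "U z0 \<noteq> x"
    have sub: "complex_vector.subspace L" and add: "\<And>u v. u \<in> L \<Longrightarrow> v \<in> L \<Longrightarrow>
        P z0 (u + v) = P z0 u + P z0 v"
      using lin(1)[of z0] by (auto simp: linear_op_on_def)
    have "U z0 \<in> L" "P z0 (U z0) = y"
      using U \<open>r > 0\<close> by auto
    moreover have "U z0 - x \<in> L"
      using \<open>U z0 \<in> L\<close> x(1) sub by (intro complex_vector.subspace_diff)
    ultimately have "P z0 (U z0 - x) = 0"
      using add[of "U z0 - x" x] x(1) by (simp add: y_def)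
    hence "det_on L (P z0) = 0"
      using \<open>U z0 - x \<in> L\<close> neq unfolding det_on_eq_0_iff[OF lin]
      by (intro bexI[of _ "U z0 - x"]) auto
    thus False
      using nz[of z0] \<open>r > 0\<close> by simp
  qed
  ultimately have "(norm x)\<^sup>2 * c \<le> norm x * norm y"
    using \<open>c > 0\<close> by (simp add: cinner_self norm_power field_simps)
  moreover have "norm x > 0"
  proof -
    have "0 < c * norm x"
      using x(2) norm_ge_zero[of "P z0 x"] by linarith
    thus ?thesis
      using \<open>c > 0\<close> by (simp add: zero_less_mult_iff)
  qed
  ultimately have "norm x * c \<le> norm y"
    by (simp add: power2_eq_square)
  thus False
    using x(2) by (simp add: y_def mult.commute)
qed

end

section \<open>Homotopy invariance of the number of zeros\<close>

lemma finite_zeros_in_cball: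
  assumes hol: "f holomorphic_on ball z0 R" and r: "0 < r" "r \<le> R'" "R' < R"
    and nz: "\<And>z. cmod (z - z0) = r \<Longrightarrow> f z \<noteq> 0"
  shows "finite {z \<in> cball z0 R'. f z = 0}"
proof (cases "f constant_on ball z0 R")
  case True
  then obtain a where a: "\<And>z. z \<in> ball z0 R \<Longrightarrow> f z = a"
    by (auto simp: constant_on_def)
  have "f (z0 + of_real r) \<noteq> 0"
    using r by (intro nz) simp
  hence "a \<noteq> 0"
    using a[of "z0 + of_real r"] r by (simp add: dist_norm)
  hence "{z \<in> cball z0 R'. f z = 0} = {}"
    using a r by force
  thus ?thesis by (simp only: finite.emptyI)
next
  case False
  show ?thesis
    by (rule holomorphic_compact_finite_zeros[OF hol open_ball _ _ _ False]) (use r in auto)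
qed

text \<open>
  The zeros of \<open>f\<close> and \<open>g\<close> could accumulate at the boundary of the ball of radius \<open>R\<close>, so the theorem
  is applied on a slightly smaller ball. There the zeros outside the circle have winding number 0
  and those inside have winding number 1.
\<close>

lemma zero_count_Rouche:
  assumes f: "f holomorphic_on ball z0 R" and g: "g holomorphic_on ball z0 R"
    and r: "0 < r" "r < R"
    and less: "\<And>z. cmod (z - z0) = r \<Longrightarrow> cmod (g z - f z) < cmod (f z)"
  shows "(\<Sum>z | cmod (z - z0) < r \<and> f z = 0. zorder f z) =
    (\<Sum>z | cmod (z - z0) < r \<and> g z = 0. zorder g z)"
proof -
  define R' where "R' = (r + R) / 2"
  have R': "r < R'" "R' < R"
    using r by (simp_all add: R'_def)
  define S where "S = ball z0 R'"
  have fin: "finite {p \<in> S. h p = 0}" if "h = f \<or> h = g" for h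
  proof (rule finite_subset)
    show "{p \<in> S. h p = 0} \<subseteq> {z \<in> cball z0 R'. h z = 0}"
      by (auto simp: S_def)
    have "h z \<noteq> 0" if "cmod (z - z0) = r" for z
      using less[OF that] \<open>h = f \<or> h = g\<close> by auto
    thus "finite {z \<in> cball z0 R'. h z = 0}"
      using f g \<open>h = f \<or> h = g\<close> r R' by (intro finite_zeros_in_cball[of h z0 R r]) auto
  qed
  have sub: "S \<subseteq> ball z0 R"
    using R' by (auto simp: S_def)
  have weighted: "(\<Sum>p | p \<in> S \<and> h p = 0. winding_number (circlepath z0 r) p * zorder h p) =
      of_int (\<Sum>z | cmod (z - z0) < r \<and> h z = 0. zorder h z)" if h: "h = f \<or> h = g" for h
  proof -
    have nz: "h z \<noteq> 0" if "cmod (z - z0) = r" for z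
      using less[OF that] h by auto
    have "(\<Sum>p | p \<in> S \<and> h p = 0. winding_number (circlepath z0 r) p * of_int (zorder h p)) =
        (\<Sum>z | cmod (z - z0) < r \<and> h z = 0. of_int (zorder h z))"
    proof (rule sum.mono_neutral_cong_right)
      show "{z. cmod (z - z0) < r \<and> h z = 0} \<subseteq> {p. p \<in> S \<and> h p = 0}"
        using R' by (auto simp: S_def dist_norm norm_minus_commute)
      show "\<forall>p\<in>{p. p \<in> S \<and> h p = 0} - {z. cmod (z - z0) < r \<and> h z = 0}.
          winding_number (circlepath z0 r) p * of_int (zorder h p) = 0"
      proof
        fix p assume p: "p \<in> {p. p \<in> S \<and> h p = 0} - {z. cmod (z - z0) < r \<and> h z = 0}"
        hence "p \<notin> cball z0 r"
          using nz[of p] by (auto simp: dist_norm norm_minus_commute)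
        hence "winding_number (circlepath z0 r) p = 0"
          using r by (intro winding_number_zero_outside[of _ "cball z0 r"]) auto
        thus "winding_number (circlepath z0 r) p * of_int (zorder h p) = 0" by simp
      qed
    qed (use fin[OF h] in \<open>simp_all add: winding_number_circlepath\<close>)
    thus ?thesis by simp
  qed
  have "(\<Sum>p\<in>{p \<in> S. f p + (g p - f p) = 0}. winding_number (circlepath z0 r) p *
        zorder (\<lambda>p. f p + (g p - f p)) p) =
      (\<Sum>p\<in>{p \<in> S. f p = 0}. winding_number (circlepath z0 r) p * zorder f p)"
  proof (rule Rouche_theorem)
    show "f holomorphic_on S" "(\<lambda>p. g p - f p) holomorphic_on S"
      using f g sub by (auto intro!: holomorphic_intros intro: holomorphic_on_subset)
    show "path_image (circlepath z0 r) \<subseteq> S"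
      using r R' by (auto simp: S_def)
    show "\<forall>z\<in>path_image (circlepath z0 r). cmod (g z - f z) < cmod (f z)"
      using less r by (auto simp: dist_norm norm_minus_commute)
    show "\<forall>z. z \<notin> S \<longrightarrow> winding_number (circlepath z0 r) z = 0"
    proof (intro allI impI)
      fix z assume "z \<notin> S"
      thus "winding_number (circlepath z0 r) z = 0"
        using r R' by (intro winding_number_zero_outside[of _ "cball z0 r"]) (auto simp: S_def)
    qed
  qed (use fin[of f] fin[of g] in \<open>auto simp: S_def\<close>)
  hence "(of_int (\<Sum>z | cmod (z - z0) < r \<and> g z = 0. zorder g z) :: complex) =
      of_int (\<Sum>z | cmod (z - z0) < r \<and> f z = 0. zorder f z)"
    using weighted[of f] weighted[of g] by simp
  thus ?thesis
    by (simp only: of_int_eq_iff)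
qed

text \<open>
  The zero count is an integer, and by Rouche's theorem it is locally constant along the
  homotopy.
\<close>

lemma zero_count_homotopy:
  fixes F :: "real \<Rightarrow> complex \<Rightarrow> complex"
  assumes hol: "\<And>t. t \<in> {0..1} \<Longrightarrow> F t holomorphic_on ball z0 R" and r: "0 < r" "r < R"
    and cont: "continuous_on ({0..1} \<times> sphere z0 r) (\<lambda>(t, z). F t z)"
    and nz: "\<And>t z. t \<in> {0..1} \<Longrightarrow> cmod (z - z0) = r \<Longrightarrow> F t z \<noteq> 0"
  shows "(\<Sum>z | cmod (z - z0) < r \<and> F 0 z = 0. zorder (F 0) z) =
    (\<Sum>z | cmod (z - z0) < r \<and> F 1 z = 0. zorder (F 1) z)"
proof -
  let ?K = "{0..1::real} \<times> sphere z0 r"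
  have K: "compact ?K" "?K \<noteq> {}"
    using r by (auto intro!: compact_Times)
  have "continuous_on ?K (\<lambda>x. cmod (case x of (t, z) \<Rightarrow> F t z))"
    by (intro continuous_on_norm cont)
  from continuous_attains_inf[OF K this] obtain t0 w0 where w0: "(t0, w0) \<in> ?K"
    and min: "\<And>t z. (t, z) \<in> ?K \<Longrightarrow> cmod (F t0 w0) \<le> cmod (F t z)"
    by auto
  define m where "m = cmod (F t0 w0)"
  have "m > 0"
    using w0 nz[of t0 w0] by (auto simp: m_def dist_norm norm_minus_commute)
  obtain d where d: "d > 0" "\<And>x y. x \<in> ?K \<Longrightarrow> y \<in> ?K \<Longrightarrow> dist y x < d \<Longrightarrow>
      dist (case y of (t, z) \<Rightarrow> F t z) (case x of (t, z) \<Rightarrow> F t z) < m"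
    using compact_uniformly_continuous[OF cont K(1)] \<open>m > 0\<close>
    unfolding uniformly_continuous_on_def by meson
  define count where "count t = (\<Sum>z | cmod (z - z0) < r \<and> F t z = 0. zorder (F t) z)" for t
  have local_const: "count s = count t" if st: "s \<in> {0..1}" "t \<in> {0..1}" "dist t s < d" for s t
    unfolding count_def
  proof (rule zero_count_Rouche[OF hol[OF st(1)] hol[OF st(2)] r])
    fix z assume z: "cmod (z - z0) = r"
    hence "z \<in> sphere z0 r"
      by (simp add: dist_norm norm_minus_commute)
    hence "dist (F t z) (F s z) < m"
      using d(2)[of "(s, z)" "(t, z)"] st by (simp add: dist_Pair_Pair)
    also have "m \<le> cmod (F s z)"
      unfolding m_def using st \<open>z \<in> sphere z0 r\<close> by (intro min) auto
    finally show "cmod (F t z - F s z) < cmod (F s z)"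
      by (simp add: dist_norm)
  qed
  have "\<forall>s\<in>{0..1}. eventually (\<lambda>t. count s = count t) (at s within {0..1})"
    unfolding eventually_at by (intro ballI exI[of _ d] conjI d(1) impI local_const) auto
  from connected_local_const[OF _ _ _ this, of 0 1] show ?thesis
    by (simp add: count_def)
qed

section \<open>Projected quadratic pencils\<close>

text \<open>
  Finite dimension makes the set of quotients bounded; otherwise the supremum would be
  meaningless.
\<close>

lemma norm_le_op_norm_on:
  assumes "finite_dim L" "linear_op_on L T" "x \<in> L" "op_norm_on L T \<le> K"
  shows "norm (T x) \<le> K * norm x"
proof (cases "x = 0")
  case True
  have "T (0 *\<^sub>C x) = 0 *\<^sub>C T x"
    using assms(2,3) unfolding linear_op_on_def by blast
  thus ?thesis
    using True by simp
next
  case False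
  obtain b where b: "orthonormal_basis L b"
    using ex_orthonormal_basis[OF assms(1)] .
  have "bdd_above ((\<lambda>x. norm (T x) / norm x) ` L)"
  proof (rule bdd_aboveI2)
    fix u assume "u \<in> L"
    from norm_linear_le_onb[OF b assms(2) this]
    show "norm (T u) / norm u \<le> (\<Sum>i<length b. norm (T (b ! i)))"
      by (cases "u = 0") (simp_all add: sum_nonneg divide_le_eq)
  qed
  hence "norm (T x) / norm x \<le> op_norm_on L T"
    unfolding op_norm_on_def using assms(3) by (intro cSUP_upper)
  hence "norm (T x) / norm x \<le> K"
    using assms(4) by linarith
  thus ?thesis
    using False by (simp add: divide_le_eq)
qed

locale projected_operator = self_adjoint +
  fixes Pr :: "'a \<Rightarrow> 'a"
  assumes Pr: "orthogonal_projection Pr"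
    and fin_range: "finite_dim (range Pr)"
    and range_Pr: "range Pr \<subseteq> domain_square D M"
begin

abbreviation "L \<equiv> range Pr"
abbreviation "P \<equiv> quadratic_pencil Pr M"

lemma Pr_add: "Pr (x + y) = Pr x + Pr y"
  and Pr_scaleC: "Pr (a *\<^sub>C x) = a *\<^sub>C Pr x"
  and Pr_idem: "Pr (Pr x) = Pr x"
  and Pr_symmetric: "cinner (Pr x) y = cinner x (Pr y)"
  using Pr by (simp_all add: orthogonal_projection_def linear_op_on_def)

lemma Pr_same: "x \<in> L \<Longrightarrow> Pr x = x"
  using Pr_idem by auto

lemma L_domain: "x \<in> L \<Longrightarrow> x \<in> D" "x \<in> L \<Longrightarrow> M x \<in> D"
  using range_Pr by (auto simp: domain_square_def)

lemma subspace_L: "complex_vector.subspace L"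
  using onb_subspace ex_orthonormal_basis[OF fin_range] by blast

lemma P_expand: "x \<in> L \<Longrightarrow> P z x = (z ^ 2) *\<^sub>C x - (2 * z) *\<^sub>C Pr (M x) + Pr (M (M x))"
  using quadratic_pencil_expand[OF linear Pr range_Pr, of x z] by (simp add: numeral_2_eq_2)

lemma P_range: "P z ` L \<subseteq> L"
  by (auto simp: quadratic_pencil_def)

lemma P_linear: "linear_op_on L (P z)"
  unfolding linear_op_on_def
proof (intro conjI ballI allI subspace_L)
  fix x y assume xy: "x \<in> L" "y \<in> L"
  hence "x + y \<in> L"
    using subspace_L by (intro complex_vector.subspace_add)
  thus "P z (x + y) = P z x + P z y"
    using xy by (simp only: P_expand) (simp add: M_add L_domain Pr_add scaleC_add_right)
next
  fix a x assume x: "x \<in> L"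
  hence "a *\<^sub>C x \<in> L"
    using subspace_L by (intro complex_vector.subspace_scale)
  thus "P z (a *\<^sub>C x) = a *\<^sub>C P z x"
    using x by (simp only: P_expand)
      (simp add: M_scaleC L_domain Pr_scaleC scaleC_add_right scaleC.diff_right scaleC_scaleC
        mult.commute)
qed

lemma P_holomorphic:
  assumes "y \<in> L"
  shows "(\<lambda>z. cinner x (P z y)) holomorphic_on S"
proof -
  have "cinner x (P z y) =
      z ^ 2 * cinner x y - 2 * z * cinner x (Pr (M y)) + cinner x (Pr (M (M y)))" for z
    by (simp add: P_expand[OF assms] cinner_add_right cinner.diff_right cinner_scaleC_right)
  thus ?thesis
    by (auto intro!: holomorphic_intros)
qed

end

locale projected_isolated_point = isolated_point + projected_operator
begin

abbreviation "Eig \<equiv> op_eigenspace D M lam"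

lemma Eig: "e \<in> Eig \<Longrightarrow> e \<in> D" "e \<in> Eig \<Longrightarrow> M e = lam *\<^sub>C e"
  by (auto simp: op_eigenspace_def)

text \<open>
  The hypothesis \<open>residual\<close> says that on projected eigenvectors \<open>P w\<close> acts almost as the scalar
  \<open>(w - lam)\<^sup>2\<close>. It enters at the conjugate point \<open>cnj z\<close>, since \<open>(z - M)\<^sup>2\<close> is moved to the
  test vector. The factor 2 in the error comes from \<open>cmod (c - 1) \<le> 2\<close>.
\<close>

lemma pencil_lower_bound:
  assumes fin: "finite_dim Eig"
    and \<delta>: "0 < \<delta>" "\<delta> \<le> cmod (z - lam)" and z: "cmod (z - lam) \<le> \<mu> / 4"
    and \<eta>: "0 \<le> \<eta>"
    and residual: "\<And>a w. a \<in> Eig \<Longrightarrow> cmod (w - lam) \<le> \<mu> / 4 \<Longrightarrow>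
      norm (P w (Pr a) - (w - lam) ^ 2 *\<^sub>C a) \<le> \<eta> * norm a"
    and v: "v \<in> L"
  shows "(\<delta>\<^sup>2 - 2 * \<eta>) * norm v \<le> norm (P z v)"
proof (cases "v = 0")
  case False
  define \<zeta> where "\<zeta> = z - lam"
  have \<zeta>: "\<zeta> \<noteq> 0" "\<delta> \<le> cmod \<zeta>" "cmod \<zeta> \<le> \<mu> / 4"
    using \<delta> z by (auto simp: \<zeta>_def)
  define T where "T w u = w *\<^sub>C u - M u" for w u
  have T_D: "T w u \<in> D" if "u \<in> L" for w u
    unfolding T_def using L_domain[OF that] by (intro D_diff D_scaleC)
  have T_symmetric: "cinner x (T w y) = cinner (T (cnj w) x) y" if "x \<in> D" "y \<in> D" for w x y
    using that by (simp add: T_def cinner.diff_left cinner.diff_right cinner_scaleC_left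
        cinner_scaleC_right symmetric)
  have P_T: "P w u = Pr (T w (T w u))" for w u
    by (simp add: quadratic_pencil_def T_def numeral_2_eq_2)
  have T_Eig: "T w e = (w - lam) *\<^sub>C e" if "e \<in> Eig" for w e
    using Eig(2)[OF that] by (simp add: T_def scaleC.diff_left)
  have T_Eig_inner: "cinner e (T z u) = \<zeta> * cinner e u" if "e \<in> Eig" "u \<in> D" for e u
    using that Eig(1)[OF that(1)]
    by (simp add: T_symmetric T_Eig cinner_scaleC_left lam_real \<zeta>_def)
  obtain b where b: "orthonormal_basis Eig b"
    using ex_orthonormal_basis[OF fin] .
  define a where "a = onb_proj b v"
  define \<beta> where "\<beta> = v - a"
  have a: "a \<in> Eig" "a \<in> D"
    using onb_proj_in[OF b] Eig(1) by (auto simp: a_def)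
  have v_eq: "v = a + \<beta>"
    by (simp add: \<beta>_def)
  have \<beta>_D: "\<beta> \<in> D"
    unfolding \<beta>_def using L_domain(1)[OF v] a(2) by (rule D_diff)
  have orth: "cinner e \<beta> = 0" if "e \<in> Eig" for e
    unfolding \<beta>_def a_def by (rule cinner_diff_onb_proj[OF b that])
  have norm_v: "(norm v)\<^sup>2 = (norm a)\<^sup>2 + (norm \<beta>)\<^sup>2"
    unfolding v_eq by (rule norm_add_square_orthogonal) (rule orth[OF a(1)])
  have T\<beta>: "T z \<beta> = T z v - \<zeta> *\<^sub>C a"
    using T_Eig[OF a(1), of z] L_domain(1)[OF v] a(2)
    by (simp add: T_def \<beta>_def M_diff \<zeta>_def scaleC.diff_right algebra_simps)
  have T\<beta>_D: "T z \<beta> \<in> D"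
    unfolding T\<beta> using T_D[OF v] a(2) by (intro D_diff D_scaleC)
  have TTv: "T z (T z v) = \<zeta>\<^sup>2 *\<^sub>C a + T z (T z \<beta>)"
  proof -
    have "T z v = T z \<beta> + \<zeta> *\<^sub>C a"
      by (simp add: T\<beta>)
    hence "T z (T z v) = T z (T z \<beta>) + \<zeta> *\<^sub>C T z a"
      using T\<beta>_D a(2)
      by (simp add: T_def M_add M_scaleC D_scaleC scaleC_add_right scaleC.diff_right
          scaleC_scaleC mult.commute)
    thus ?thesis
      using T_Eig[OF a(1), of z] by (simp add: \<zeta>_def scaleC_scaleC power2_eq_square)
  qed
  \<comment> \<open>On the complement of the eigenspace the gap makes the squared operator accretive.\<close>
  have complement: "\<delta>\<^sup>2 * (norm \<beta>)\<^sup>2 \<le> Re (cinner \<beta> (T z (T z \<beta>)))"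
  proof -
    define p where "p = M \<beta> - lam *\<^sub>C \<beta>"
    have gap: "\<mu> * norm \<beta> \<le> norm p"
      unfolding p_def using \<beta>_D orth by (rule spectral_gap)
    have T\<beta>_p: "T z \<beta> = \<zeta> *\<^sub>C \<beta> - p" "T (cnj z) \<beta> = cnj \<zeta> *\<^sub>C \<beta> - p"
      by (simp_all add: T_def p_def \<zeta>_def lam_real scaleC.diff_left)
    have "cinner \<beta> (T z (T z \<beta>)) = cinner (T (cnj z) \<beta>) (T z \<beta>)"
      by (rule T_symmetric[OF \<beta>_D T\<beta>_D])
    also have "\<dots> = \<zeta>\<^sup>2 * (norm \<beta>)\<^sup>2 - \<zeta> * (cinner \<beta> p + cinner p \<beta>) + (norm p)\<^sup>2"
      unfolding T\<beta>_p
      by (simp add: cinner.diff_left cinner.diff_right cinner_scaleC_left cinner_scaleC_right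
          cinner_self power2_eq_square algebra_simps)
    finally have eq: "Re (cinner \<beta> (T z (T z \<beta>))) =
        Re (\<zeta>\<^sup>2 * (norm \<beta>)\<^sup>2 - \<zeta> * (cinner \<beta> p + cinner p \<beta>)) + (norm p)\<^sup>2"
      by simp
    have "cmod (\<zeta>\<^sup>2 * (norm \<beta>)\<^sup>2 - \<zeta> * (cinner \<beta> p + cinner p \<beta>)) \<le>
        (cmod \<zeta> * norm \<beta>)\<^sup>2 + cmod \<zeta> * (norm \<beta> * norm p + norm p * norm \<beta>)"
    proof (rule order_trans[OF norm_triangle_ineq4] , rule add_mono)
      show "cmod (\<zeta>\<^sup>2 * (norm \<beta>)\<^sup>2) \<le> (cmod \<zeta> * norm \<beta>)\<^sup>2"
        by (simp add: norm_mult norm_power power_mult_distrib)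
      have "cmod (cinner \<beta> p + cinner p \<beta>) \<le> norm \<beta> * norm p + norm p * norm \<beta>"
        by (intro order_trans[OF norm_triangle_ineq] add_mono norm_cinner_le)
      thus "cmod (\<zeta> * (cinner \<beta> p + cinner p \<beta>)) \<le>
          cmod \<zeta> * (norm \<beta> * norm p + norm p * norm \<beta>)"
        unfolding norm_mult by (rule mult_left_mono) simp
    qed
    moreover have quarter: "cmod \<zeta> * norm \<beta> \<le> norm p / 4"
      using gap mult_right_mono[OF \<zeta>(3), of "norm \<beta>"] by simp
    have "(cmod \<zeta> * norm \<beta>)\<^sup>2 \<le> (norm p / 4)\<^sup>2"
      using quarter by (intro power_mono) simp_all
    moreover have "cmod \<zeta> * (norm \<beta> * norm p + norm p * norm \<beta>) \<le> 2 * (norm p / 4 * norm p)"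
      using mult_right_mono[OF quarter, of "norm p"] by (simp add: algebra_simps)
    ultimately have "cmod (\<zeta>\<^sup>2 * (norm \<beta>)\<^sup>2 - \<zeta> * (cinner \<beta> p + cinner p \<beta>)) \<le>
        9 / 16 * (norm p)\<^sup>2"
      by (simp add: power2_eq_square)
    hence "- (9 / 16 * (norm p)\<^sup>2) \<le> Re (\<zeta>\<^sup>2 * (norm \<beta>)\<^sup>2 - \<zeta> * (cinner \<beta> p + cinner p \<beta>))"
      using abs_Re_le_cmod[of "\<zeta>\<^sup>2 * (norm \<beta>)\<^sup>2 - \<zeta> * (cinner \<beta> p + cinner p \<beta>)"] by linarith
    hence "7 / 16 * (norm p)\<^sup>2 \<le> Re (cinner \<beta> (T z (T z \<beta>)))"
      unfolding eq by simp
    moreover have "(\<delta> * norm \<beta>)\<^sup>2 \<le> (norm p / 4)\<^sup>2"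
    proof (rule power_mono)
      show "\<delta> * norm \<beta> \<le> norm p / 4"
        using mult_right_mono[OF \<zeta>(2), of "norm \<beta>"] quarter by simp
    qed (use \<delta>(1) in simp)
    moreover have "(norm p / 4)\<^sup>2 \<le> 7 / 16 * (norm p)\<^sup>2"
      by (simp add: power_divide)
    ultimately show ?thesis
      by (simp add: power_mult_distrib)
  qed
  \<comment> \<open>Rotating the eigenspace component of the test vector aligns its phase with the complement.\<close>
  define c where "c = sgn (\<zeta>\<^sup>2)"
  have c: "cmod c = 1"
    using \<zeta>(1) by (simp add: c_def norm_sgn)
  define w where "w = c *\<^sub>C a + \<beta>"
  have norm_w: "norm w = norm v"
  proof -
    have "(norm w)\<^sup>2 = (norm (c *\<^sub>C a))\<^sup>2 + (norm \<beta>)\<^sup>2"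
      unfolding w_def
      by (rule norm_add_square_orthogonal) (simp add: cinner_scaleC_left orth[OF a(1)])
    hence "(norm w)\<^sup>2 = (norm v)\<^sup>2"
      by (simp add: norm_scaleC c norm_v)
    thus ?thesis
      by (simp add: power2_eq_iff_nonneg)
  qed
  have full: "\<delta>\<^sup>2 * (norm v)\<^sup>2 \<le> Re (cinner w (T z (T z v)))"
  proof -
    have "cinner a (T z (T z \<beta>)) = 0"
      using T_Eig_inner[OF a(1) T\<beta>_D] T_Eig_inner[OF a(1) \<beta>_D] orth[OF a(1)] by simp
    moreover have "cinner \<beta> a = 0"
      using orth[OF a(1)] cinner_eq_0_commute by blast
    ultimately have "cinner w (T z (T z v)) =
        (cnj c * \<zeta>\<^sup>2) * (norm a)\<^sup>2 + cinner \<beta> (T z (T z \<beta>))"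
      unfolding w_def TTv
      by (simp add: cinner_add_left cinner_add_right cinner_scaleC_left cinner_scaleC_right
          cinner_self)
    moreover have "cnj c * \<zeta>\<^sup>2 = complex_of_real (cmod (\<zeta>\<^sup>2))"
      using complex_norm_square[of "\<zeta>\<^sup>2"] \<zeta>(1) unfolding c_def
      by (simp add: sgn_eq mult.commute power2_eq_square field_simps)
    ultimately have "Re (cinner w (T z (T z v))) =
        (cmod \<zeta>)\<^sup>2 * (norm a)\<^sup>2 + Re (cinner \<beta> (T z (T z \<beta>)))"
      by (simp add: norm_power)
    moreover have "\<delta>\<^sup>2 * (norm a)\<^sup>2 \<le> (cmod \<zeta>)\<^sup>2 * (norm a)\<^sup>2"
      using \<delta>(1) \<zeta>(2) by (intro mult_right_mono power_mono) simp_all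
    ultimately show ?thesis
      using complement by (simp add: norm_v distrib_left)
  qed
  have truncation: "cmod (cinner w (P z v) - cinner w (T z (T z v))) \<le> 2 * \<eta> * (norm v)\<^sup>2"
  proof -
    have w_eq: "w = v + (c - 1) *\<^sub>C a"
      by (simp add: w_def \<beta>_def scaleC.diff_left)
    hence Pr_w: "Pr w = v + (c - 1) *\<^sub>C Pr a"
      by (simp add: Pr_add Pr_scaleC Pr_same[OF v])
    have "cinner w (P z v) = cinner (Pr w) (T z (T z v))"
      by (simp add: P_T Pr_symmetric)
    hence "cinner w (P z v) - cinner w (T z (T z v)) =
        cnj (c - 1) * (cinner (Pr a) (T z (T z v)) - cinner a (T z (T z v)))"
      unfolding Pr_w unfolding w_eq
      by (simp only: cinner_add_left cinner_scaleC_left) (simp add: algebra_simps)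
    moreover have "cinner (Pr a) (T z (T z v)) = cinner (P (cnj z) (Pr a)) v"
    proof -
      have "cinner (Pr a) (T z (T z v)) = cinner (T (cnj z) (T (cnj z) (Pr a))) v"
        using T_D L_domain v by (simp add: T_symmetric)
      also have "\<dots> = cinner (T (cnj z) (T (cnj z) (Pr a))) (Pr v)"
        by (simp add: Pr_same[OF v])
      finally show ?thesis
        by (simp add: P_T Pr_symmetric)
    qed
    moreover have "cinner a (T z (T z v)) = cinner ((cnj z - lam) ^ 2 *\<^sub>C a) v"
      using T_Eig_inner[OF a(1)] T_D[OF v] L_domain(1)[OF v]
      by (simp add: cinner_scaleC_left \<zeta>_def lam_real power2_eq_square)
    ultimately have eq: "cinner w (P z v) - cinner w (T z (T z v)) =
        cnj (c - 1) * cinner (P (cnj z) (Pr a) - (cnj z - lam) ^ 2 *\<^sub>C a) v"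
      by (simp add: cinner.diff_left)
    have "cmod (cnj z - lam) = cmod (cnj (z - lam))"
      by (simp add: lam_real)
    hence "cmod (cnj z - lam) \<le> \<mu> / 4"
      using z by (simp only: complex_mod_cnj)
    hence res: "norm (P (cnj z) (Pr a) - (cnj z - lam) ^ 2 *\<^sub>C a) \<le> \<eta> * norm v"
    proof (rule order_trans[OF residual[OF a(1)]])
      have "(norm a)\<^sup>2 \<le> (norm v)\<^sup>2"
        unfolding norm_v by simp
      hence "norm a \<le> norm v"
        by (rule power2_le_imp_le) simp
      thus "\<eta> * norm a \<le> \<eta> * norm v"
        using \<eta> by (rule mult_left_mono)
    qed
    have "cmod (cnj (c - 1)) \<le> 2"
      using norm_triangle_ineq4[of c 1] c by (simp only: complex_mod_cnj) simp
    moreover have "cmod (cinner (P (cnj z) (Pr a) - (cnj z - lam) ^ 2 *\<^sub>C a) v) \<le>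
        \<eta> * norm v * norm v"
      using mult_right_mono[OF res, of "norm v"] by (intro order_trans[OF norm_cinner_le]) simp
    ultimately have "cmod (cnj (c - 1)) *
        cmod (cinner (P (cnj z) (Pr a) - (cnj z - lam) ^ 2 *\<^sub>C a) v) \<le> 2 * (\<eta> * norm v * norm v)"
      by (intro mult_mono) simp_all
    thus ?thesis
      unfolding eq norm_mult by (simp add: power2_eq_square mult.assoc)
  qed
  have "(\<delta>\<^sup>2 - 2 * \<eta>) * (norm v)\<^sup>2 \<le>
      cmod (cinner w (T z (T z v))) - cmod (cinner w (P z v) - cinner w (T z (T z v)))"
    using full truncation complex_Re_le_cmod[of "cinner w (T z (T z v))"]
    by (simp add: left_diff_distrib)
  also have "\<dots> \<le> cmod (cinner w (P z v))"
    using norm_triangle_ineq2[of "cinner w (T z (T z v))" "cinner w (T z (T z v)) - cinner w (P z v)"]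
    by (simp add: norm_minus_commute)
  also have "\<dots> \<le> norm v * norm (P z v)"
    using norm_cinner_le[of w "P z v"] by (simp add: norm_w)
  finally have "norm v * ((\<delta>\<^sup>2 - 2 * \<eta>) * norm v) \<le> norm v * norm (P z v)"
    by (simp add: power2_eq_square mult_ac)
  thus ?thesis
    using False by simp
qed simp

text \<open>
  The residual \<open>\<delta>\<^sup>2 / 8\<close> leaves the lower bound \<open>\<delta>\<^sup>2 - \<delta>\<^sup>2 / 4 \<ge> \<delta>\<^sup>2 / 2\<close> on the annulus, which
  beats \<open>q\<close>. It also makes \<open>norm (P lam (Pr \<psi>))\<close> smaller than \<open>\<delta>\<^sup>2 / 2 * norm (Pr \<psi>)\<close>, because
  \<open>norm (Pr \<psi>)\<close> is at least half of \<open>norm \<psi>\<close>; this forces an eigenvalue of \<open>P\<close> in the disc, and the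
  equality of the counts passes it on to \<open>PQ\<close>.
\<close>

lemma eigenvalues_of_perturbed_pencil:
  assumes fin: "finite_dim Eig" and \<delta>: "0 < \<delta>" "\<delta> < \<mu> / 4"
    and residual: "\<And>a w. a \<in> Eig \<Longrightarrow> cmod (w - lam) \<le> \<mu> / 4 \<Longrightarrow>
      norm (P w (Pr a) - (w - lam) ^ 2 *\<^sub>C a) \<le> \<delta>\<^sup>2 / 8 * norm a"
    and \<psi>: "\<psi> \<in> Eig" "\<psi> \<noteq> 0" "norm (Pr \<psi> - \<psi>) \<le> norm \<psi> / 2"
    and Q_lin: "\<And>z. linear_op_on L (Q z)" "\<And>z. Q z ` L \<subseteq> L"
    and Q_hol: "\<And>x y. x \<in> L \<Longrightarrow> y \<in> L \<Longrightarrow> (\<lambda>z. cinner x (Q z y)) holomorphic_on UNIV"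
    and Q_le: "\<And>z x. cmod (z - lam) \<le> \<mu> / 4 \<Longrightarrow> x \<in> L \<Longrightarrow> norm (Q z x) \<le> q * norm x"
    and q: "q < \<delta>\<^sup>2 / 2"
  defines "PQ \<equiv> \<lambda>z x. P z x + Q z x"
  shows "pencil_spectrum L PQ \<inter> {z. \<delta> \<le> cmod (z - lam) \<and> cmod (z - lam) \<le> \<mu> / 4} = {}"
    and "pencil_spectrum L PQ \<inter> {z. cmod (z - lam) < \<delta>} \<noteq> {}"
    and "count_eigenvalues L P {z. cmod (z - lam) < \<delta>} =
      count_eigenvalues L PQ {z. cmod (z - lam) < \<delta>}"
proof -
  have lower: "\<delta>\<^sup>2 / 2 * norm v \<le> norm (P z v)"
    if "\<delta> \<le> cmod (z - lam)" "cmod (z - lam) \<le> \<mu> / 4" "v \<in> L" for z v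
  proof -
    have "\<delta>\<^sup>2 / 2 * norm v \<le> (\<delta>\<^sup>2 - 2 * (\<delta>\<^sup>2 / 8)) * norm v"
      by (intro mult_right_mono) simp_all
    also have "\<dots> \<le> norm (P z v)"
      using that \<delta>(1) by (intro pencil_lower_bound[OF fin _ _ _ _ residual]) auto
    finally show ?thesis .
  qed
  define H where "H t z x = P z x + complex_of_real t *\<^sub>C Q z x" for t z x
  have H_lin: "linear_op_on L (H t z)" and H_range: "H t z ` L \<subseteq> L" for t z
  proof -
    show "linear_op_on L (H t z)"
      using P_linear[of z] Q_lin(1)[of z]
      by (auto simp: linear_op_on_def H_def scaleC_add_right scaleC_scaleC mult.commute)
    show "H t z ` L \<subseteq> L"
      using P_range[of z] Q_lin(2)[of z] subspace_L unfolding H_def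
      by (intro image_subsetI complex_vector.subspace_add complex_vector.subspace_scale) auto
  qed
  have H_inner: "cinner x (H t z y) = cinner x (P z y) + of_real t * cinner x (Q z y)" for x t z y
    by (simp add: H_def cinner_add_right cinner_scaleC_right)
  define F where "F t z = det_on L (H t z)" for t z
  have F_0: "F 0 = (\<lambda>z. det_on L (P z))" and F_1: "F 1 = (\<lambda>z. det_on L (PQ z))"
  proof -
    have H_ends: "H 0 z = P z" "H 1 z = PQ z" for z
      by (simp_all add: H_def PQ_def scaleC_one fun_eq_iff)
    show "F 0 = (\<lambda>z. det_on L (P z))" "F 1 = (\<lambda>z. det_on L (PQ z))"
      by (rule ext, simp only: F_def H_ends)+
  qed
  have F_hol: "F t holomorphic_on S" for t S
    unfolding F_def using P_holomorphic Q_hol holomorphic_on_subset[OF Q_hol, of _ _ S]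
    by (intro det_on_holomorphic[OF fin_range]) (auto simp: H_inner intro!: holomorphic_intros)
  have F_nz: "F t z \<noteq> 0"
    if t: "t \<in> {0..1}" and z: "\<delta> \<le> cmod (z - lam)" "cmod (z - lam) \<le> \<mu> / 4" for t z
  proof
    assume "F t z = 0"
    then obtain v where v: "v \<in> L" "v \<noteq> 0" "H t z v = 0"
      unfolding F_def det_on_eq_0_iff[OF fin_range H_lin H_range] by blast
    have "P z v = - (complex_of_real t *\<^sub>C Q z v)"
      using v(3) by (simp add: H_def eq_neg_iff_add_eq_0)
    hence "norm (P z v) \<le> norm (Q z v)"
      using t by (simp add: norm_scaleC mult_left_le_one_le)
    also have "\<dots> \<le> q * norm v"
      using z(2) v(1) by (rule Q_le)
    also have "\<dots> < \<delta>\<^sup>2 / 2 * norm v"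
      using q v(2) by simp
    finally show False
      using lower[OF z v(1)] by simp
  qed
  show empty: "pencil_spectrum L PQ \<inter> {z. \<delta> \<le> cmod (z - lam) \<and> cmod (z - lam) \<le> \<mu> / 4} = {}"
    using F_nz[of 1] by (auto simp: pencil_spectrum_def F_1)
  have count_F: "count_eigenvalues L P {z. cmod (z - lam) < \<delta>} =
      (\<Sum>z | cmod (z - lam) < \<delta> \<and> F 0 z = 0. zorder (F 0) z)"
    "count_eigenvalues L PQ {z. cmod (z - lam) < \<delta>} =
      (\<Sum>z | cmod (z - lam) < \<delta> \<and> F 1 z = 0. zorder (F 1) z)"
    unfolding count_eigenvalues_def pencil_spectrum_def F_0 F_1
    by (auto intro!: sum.cong)
  have "(\<Sum>z | cmod (z - lam) < \<delta> \<and> F 0 z = 0. zorder (F 0) z) =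
      (\<Sum>z | cmod (z - lam) < \<delta> \<and> F 1 z = 0. zorder (F 1) z)"
  proof (rule zero_count_homotopy[OF F_hol \<delta>])
    have "continuous_on ({0..1} \<times> sphere lam \<delta>) (\<lambda>p. det_on L (H (fst p) (snd p)))"
    proof (rule det_on_continuous[OF fin_range])
      fix x y assume xy: "x \<in> L" "y \<in> L"
      have "continuous_on UNIV (\<lambda>z. cinner x (P z y))" "continuous_on UNIV (\<lambda>z. cinner x (Q z y))"
        using P_holomorphic[OF xy(2)] Q_hol[OF xy]
        by (auto intro: holomorphic_on_imp_continuous_on)
      from this[THEN continuous_on_compose2, OF continuous_on_snd[OF continuous_on_id] subset_UNIV]
      show "continuous_on ({0..1} \<times> sphere lam \<delta>) (\<lambda>p. cinner x (H (fst p) (snd p) y))"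
        unfolding H_inner by (intro continuous_on_add continuous_on_mult continuous_intros)
    qed
    thus "continuous_on ({0..1} \<times> sphere lam \<delta>) (\<lambda>(t, z). F t z)"
      by (simp add: F_def case_prod_unfold)
  qed (use F_nz \<delta> in auto)
  thus count: "count_eigenvalues L P {z. cmod (z - lam) < \<delta>} =
      count_eigenvalues L PQ {z. cmod (z - lam) < \<delta>}"
    by (simp only: count_F)
  have "\<exists>z. cmod (z - lam) < \<delta> \<and> det_on L (P z) = 0"
  proof (rule det_on_has_zero[OF fin_range P_linear P_range P_holomorphic \<delta>(1)])
    show "0 < \<delta>\<^sup>2 / 2"
      using \<delta> by simp
    show "\<delta>\<^sup>2 / 2 * norm v \<le> norm (P z v)" if "cmod (z - lam) = \<delta>" "v \<in> L" for z v
      using that \<delta> by (intro lower) auto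
    have "norm (P lam (Pr \<psi>)) \<le> \<delta>\<^sup>2 / 8 * norm \<psi>"
      using residual[OF \<psi>(1), of lam] \<mu>_pos by simp
    also have "\<dots> < \<delta>\<^sup>2 / 2 * (norm \<psi> / 2)"
      using \<delta>(1) \<psi>(2) by simp
    also have "\<dots> \<le> \<delta>\<^sup>2 / 2 * norm (Pr \<psi>)"
      using \<psi>(3) norm_triangle_ineq2[of \<psi> "\<psi> - Pr \<psi>"]
      by (intro mult_left_mono) (simp_all add: norm_minus_commute)
    finally show "norm (P lam (Pr \<psi>)) < \<delta>\<^sup>2 / 2 * norm (Pr \<psi>)" .
  qed auto
  then obtain z1 where z1: "cmod (z1 - lam) < \<delta>" "F 0 z1 = 0"
    by (auto simp: F_0)
  have zeros: "finite {z. cmod (z - lam) \<le> \<delta> \<and> F 0 z = 0}"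
  proof -
    have "finite {z \<in> cball lam \<delta>. F 0 z = 0}"
      using \<delta> F_nz[of 0] by (intro finite_zeros_in_cball[OF F_hol[of 0 "ball lam (\<mu> / 4)"]]) auto
    thus ?thesis
      by (simp add: dist_norm norm_minus_commute)
  qed
  have pos: "0 < zorder (F 0) z" if z: "cmod (z - lam) < \<delta>" "F 0 z = 0" for z
  proof -
    have "open {w. cmod (w - lam) < \<delta>}"
      by (intro open_Collect_less continuous_intros)
    hence "\<forall>\<^sub>F w in at z. cmod (w - lam) < \<delta>"
      using z(1) eventually_at_in_open'[of "{w. cmod (w - lam) < \<delta>}" z] by simp
    moreover have "\<forall>\<^sub>F w in at z. w \<notin> {z. cmod (z - lam) \<le> \<delta> \<and> F 0 z = 0}"
      using islimpt_finite[OF zeros] by (simp add: islimpt_iff_eventually)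
    ultimately have "\<forall>\<^sub>F w in at z. F 0 w \<noteq> 0"
      by eventually_elim auto
    hence "\<exists>\<^sub>F w in at z. F 0 w \<noteq> 0"
      by (intro eventually_frequently) simp_all
    from zorder_pos_iff[OF F_hol open_UNIV UNIV_I this] show ?thesis
      using z(2) by simp
  qed
  have "0 < count_eigenvalues L P {z. cmod (z - lam) < \<delta>}"
    unfolding count_F
  proof (rule sum_pos)
    show "finite {z. cmod (z - lam) < \<delta> \<and> F 0 z = 0}"
      by (rule finite_subset[OF _ zeros]) auto
  qed (use z1 pos in auto)
  hence "count_eigenvalues L PQ {z. cmod (z - lam) < \<delta>} \<noteq> 0"
    using count by simp
  thus "pencil_spectrum L PQ \<inter> {z. cmod (z - lam) < \<delta>} \<noteq> {}"
    by (auto simp: count_eigenvalues_def)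
qed

text \<open>
  Expanding both squares pairs the three terms of the pencil with the three convergence hypotheses.
  The residual is linear in \<open>a\<close>, so its values on an orthonormal basis give a bound that is uniform
  on the eigenspace.
\<close>

lemma residual_le:
  assumes b: "orthonormal_basis Eig b" and a: "a \<in> Eig" and z: "cmod z \<le> K"
  shows "norm (P z (Pr a) - (z - lam) ^ 2 *\<^sub>C a) \<le>
    (\<Sum>i<length b. K\<^sup>2 * norm (Pr (Pr (b ! i)) - b ! i) +
       2 * K * norm (Pr (M (Pr (b ! i))) - lam *\<^sub>C b ! i) +
       norm (Pr (M (M (Pr (b ! i)))) - lam\<^sup>2 *\<^sub>C b ! i)) * norm a"
proof -
  define T where "T a = P z (Pr a) - (z - lam) ^ 2 *\<^sub>C a" for a
  have "linear_op_on Eig T"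
    using P_linear[of z] onb_subspace[OF b]
    by (auto simp: linear_op_on_def T_def Pr_add Pr_scaleC scaleC_add_right scaleC.diff_right
        scaleC_scaleC mult.commute)
  hence "norm (T a) \<le> (\<Sum>i<length b. norm (T (b ! i))) * norm a"
    using a by (rule norm_linear_le_onb[OF b])
  moreover have "norm (T e) \<le> K\<^sup>2 * norm (Pr (Pr e) - e) + 2 * K * norm (Pr (M (Pr e)) - lam *\<^sub>C e) +
      norm (Pr (M (M (Pr e))) - lam\<^sup>2 *\<^sub>C e)" for e
  proof -
    have sq: "(z - lam) ^ 2 = z ^ 2 - 2 * z * lam + lam ^ 2"
      by (simp add: power2_eq_square algebra_simps)
    have "T e = z ^ 2 *\<^sub>C (Pr (Pr e) - e) - (2 * z) *\<^sub>C (Pr (M (Pr e)) - lam *\<^sub>C e) +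
        (Pr (M (M (Pr e))) - lam\<^sup>2 *\<^sub>C e)"
      unfolding T_def sq
      by (simp add: P_expand Pr_idem scaleC.diff_left scaleC_add_left scaleC.diff_right scaleC_scaleC)
    also have "norm \<dots> \<le> norm (z ^ 2 *\<^sub>C (Pr (Pr e) - e)) +
        norm ((2 * z) *\<^sub>C (Pr (M (Pr e)) - lam *\<^sub>C e)) +
        norm (Pr (M (M (Pr e))) - lam\<^sup>2 *\<^sub>C e)"
      by (intro order_trans[OF norm_triangle_ineq] add_right_mono norm_triangle_ineq4)
    also have "norm (z ^ 2 *\<^sub>C (Pr (Pr e) - e)) \<le> K\<^sup>2 * norm (Pr (Pr e) - e)"
      unfolding norm_scaleC norm_power using z by (intro mult_right_mono power_mono) simp_all
    also have "norm ((2 * z) *\<^sub>C (Pr (M (Pr e)) - lam *\<^sub>C e)) \<le>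
        2 * K * norm (Pr (M (Pr e)) - lam *\<^sub>C e)"
      unfolding norm_scaleC using z by (intro mult_right_mono) (simp_all add: norm_mult)
    finally show ?thesis by simp
  qed
  ultimately show ?thesis
    unfolding T_def[symmetric]
    by (meson mult_right_mono norm_ge_zero order_trans sum_mono)
qed

end

theorem theorem2:
  fixes D :: "'h :: complex_hilbert set"
    and M :: "'h \<Rightarrow> 'h"
    and Pr :: "nat \<Rightarrow> 'h \<Rightarrow> 'h"
    and lam :: complex
    and \<mu> \<delta> w0 w1 :: real
  assumes "separable_space (euclidean :: 'h topology)"
    and "self_adjoint_op D M"
    and "\<And>n. orthogonal_projection (Pr n)"
    and "\<And>n. finite_dim (range (Pr n))"
    and "\<And>n. range (Pr n) \<subseteq> domain_square D M"
    and "lam \<in> discrete_spectrum D M"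
    and "op_spectrum D M - {lam} \<noteq> {}"
    and \<mu>_def: "\<mu> = infdist lam (op_spectrum D M - {lam})"
    and "\<And>\<psi> k. \<psi> \<in> D \<Longrightarrow> M \<psi> = lam *\<^sub>C \<psi> \<Longrightarrow> k \<in> {0, 1, 2} \<Longrightarrow>
           (\<lambda>n. norm (Pr n ((M ^^ k) (Pr n \<psi>)) - (lam ^ k) *\<^sub>C \<psi>)) \<longlonglongrightarrow> 0"
    and "w0 \<ge> 0" "w1 \<ge> 0" "(w0, w1) \<noteq> (0, 0)"
    and "0 < \<delta>" "\<delta> < \<mu> / 4"
  shows "\<exists>N>0. \<forall>\<epsilon>. 0 \<le> \<epsilon> \<and>
           \<epsilon> < \<delta>\<^sup>2 * \<mu>\<^sup>2 / (2 * (2 * \<delta>\<^sup>2 + 3 * \<mu>\<^sup>2) * (w0 + w1 * (\<mu> / 4 + cmod lam))) \<longrightarrow>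
           (\<forall>Q \<in> linear_perturbations (\<lambda>n. range (Pr n)) \<epsilon> (w0, w1). \<forall>n>N.
              let L = range (Pr n);
                  P = quadratic_pencil (Pr n) M;
                  PQ = (\<lambda>z x. P z x + Q n z x)
              in pencil_spectrum L PQ \<inter> {z. \<delta> \<le> cmod (z - lam) \<and> cmod (z - lam) \<le> \<mu> / 4} = {} \<and>
                 pencil_spectrum L PQ \<inter> {z. cmod (z - lam) < \<delta>} \<noteq> {} \<and>
                 count_eigenvalues L P {z. cmod (z - lam) < \<delta>} =
                   count_eigenvalues L PQ {z. cmod (z - lam) < \<delta>})"
proof -
  interpret self_adjoint D M
    by unfold_locales (rule assms(2))
  note Pr = assms(3) and fin_range = assms(4) and range_Pr = assms(5) and conv = assms(9)
    and w = assms(10,11,12) and \<delta> = assms(13,14)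
  define Eig where "Eig = op_eigenspace D M lam"
  have fin: "finite_dim Eig" and nontrivial: "Eig \<noteq> {0}"
    using assms(6) by (simp_all add: discrete_spectrum_def Eig_def)
  obtain b where b: "orthonormal_basis Eig b"
    using ex_orthonormal_basis[OF fin] .
  obtain \<psi> where \<psi>: "\<psi> \<in> Eig" "\<psi> \<noteq> 0"
    using nontrivial complex_vector.subspace_0[OF onb_subspace[OF b]] by blast
  have Eig: "e \<in> D" "M e = lam *\<^sub>C e" if "e \<in> Eig" for e
    using that by (auto simp: Eig_def op_eigenspace_def)
  have "lam * cinner \<psi> \<psi> = cnj lam * cinner \<psi> \<psi>"
    using symmetric[of \<psi> \<psi>] Eig[OF \<psi>(1)] by (simp add: cinner_scaleC_left cinner_scaleC_right)
  hence lam_real: "cnj lam = lam"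
    using \<psi>(2) by (simp add: cinner_self)
  have isolated: "isolated_point D M lam \<mu>"
  proof unfold_locales
    fix z assume z: "z \<noteq> lam" "cmod (z - lam) < \<mu>"
    show "z \<in> op_resolvent_set D M"
    proof (rule ccontr)
      assume "z \<notin> op_resolvent_set D M"
      hence "z \<in> op_spectrum D M - {lam}"
        using z(1) by (simp add: op_spectrum_def)
      hence "\<mu> \<le> dist lam z"
        unfolding \<mu>_def by (rule infdist_le)
      thus False
        using z(2) by (simp add: dist_norm norm_minus_commute)
    qed
  qed (use lam_real \<delta> in auto)
  have projected: "projected_isolated_point D M lam \<mu> (Pr n)" for n
    using isolated Pr fin_range range_Pr
    by (intro projected_isolated_point.intro projected_operator.intro projected_operator_axioms.intro)
       (auto simp: self_adjoint_axioms)
  define K where "K = \<mu> / 4 + cmod lam"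
  have K: "K > 0" "cmod z \<le> K" if "cmod (z - lam) \<le> \<mu> / 4" for z
    using norm_triangle_ineq[of "z - lam" lam] that \<delta> by (auto simp: K_def intro: add_pos_nonneg)
  define \<eta> where "\<eta> n = (\<Sum>i<length b. K\<^sup>2 * norm (Pr n (Pr n (b ! i)) - b ! i) +
       2 * K * norm (Pr n (M (Pr n (b ! i))) - lam *\<^sub>C b ! i) +
       norm (Pr n (M (M (Pr n (b ! i)))) - lam\<^sup>2 *\<^sub>C b ! i))" for n
  have conv':
    "(\<lambda>n. norm (Pr n (Pr n e) - e)) \<longlonglongrightarrow> 0"
    "(\<lambda>n. norm (Pr n (M (Pr n e)) - lam *\<^sub>C e)) \<longlonglongrightarrow> 0"
    "(\<lambda>n. norm (Pr n (M (M (Pr n e))) - lam\<^sup>2 *\<^sub>C e)) \<longlonglongrightarrow> 0" if "e \<in> Eig" for e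
    using conv[OF Eig[OF that], of 0] conv[OF Eig[OF that], of 1] conv[OF Eig[OF that], of 2]
    by (simp_all add: scaleC_one numeral_2_eq_2)
  have "\<eta> \<longlonglongrightarrow> (\<Sum>i<length b. K\<^sup>2 * 0 + 2 * K * 0 + 0)"
    unfolding \<eta>_def by (intro tendsto_intros conv') (auto simp: onb_nth_in[OF b])
  hence "\<eta> \<longlonglongrightarrow> 0"
    by simp
  moreover have "0 < \<delta>\<^sup>2 / 8"
    using \<delta>(1) by simp
  ultimately have "\<forall>\<^sub>F n in sequentially. \<eta> n < \<delta>\<^sup>2 / 8"
    by (rule order_tendstoD(2))
  moreover have "0 < norm \<psi> / 2"
    using \<psi>(2) by simp
  from order_tendstoD(2)[OF conv'(1)[OF \<psi>(1)] this]
  have "\<forall>\<^sub>F n in sequentially. norm (Pr n (Pr n \<psi>) - \<psi>) < norm \<psi> / 2" .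
  ultimately obtain N0 where N0: "\<And>n. n \<ge> N0 \<Longrightarrow>
      \<eta> n < \<delta>\<^sup>2 / 8 \<and> norm (Pr n (Pr n \<psi>) - \<psi>) < norm \<psi> / 2"
    unfolding eventually_sequentially by (meson le_trans nle_le)
  define W where "W = w0 + w1 * K"
  have W: "W > 0"
    using w K[of lam] \<delta> unfolding W_def by (cases "w0 = 0") (auto intro: add_pos_nonneg)
  show ?thesis
  proof (intro exI[of _ "Suc N0"] conjI allI impI ballI)
    fix \<epsilon> Q n
    assume \<epsilon>: "0 \<le> \<epsilon> \<and>
        \<epsilon> < \<delta>\<^sup>2 * \<mu>\<^sup>2 / (2 * (2 * \<delta>\<^sup>2 + 3 * \<mu>\<^sup>2) * (w0 + w1 * (\<mu> / 4 + cmod lam)))"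
      and Q: "Q \<in> linear_perturbations (\<lambda>n. range (Pr n)) \<epsilon> (w0, w1)" and n: "n > Suc N0"
    interpret projected_isolated_point D M lam \<mu> "Pr n"
      by (rule projected)
    obtain Fs Gs where FG: "\<forall>n\<ge>1.
        linear_op_on (range (Pr n)) (Fs n) \<and> Fs n ` range (Pr n) \<subseteq> range (Pr n) \<and>
        op_norm_on (range (Pr n)) (Fs n) \<le> snd (w0, w1) * \<epsilon> \<and>
        linear_op_on (range (Pr n)) (Gs n) \<and> Gs n ` range (Pr n) \<subseteq> range (Pr n) \<and>
        op_norm_on (range (Pr n)) (Gs n) \<le> fst (w0, w1) * \<epsilon> \<and>
        (\<forall>z. \<forall>x\<in>range (Pr n). Q n z x = z *\<^sub>C Fs n x - Gs n x)"
      using Q unfolding linear_perturbations_def mem_Collect_eq by (elim exE)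
    define F G where "F = Fs n" and "G = Gs n"
    have "n \<ge> 1"
      using n by simp
    note FG_n = FG[rule_format, OF this, folded F_def G_def, unfolded fst_conv snd_conv]
    have F: "linear_op_on L F" "F ` L \<subseteq> L" "op_norm_on L F \<le> w1 * \<epsilon>"
      and G: "linear_op_on L G" "G ` L \<subseteq> L" "op_norm_on L G \<le> w0 * \<epsilon>"
      using FG_n by blast+
    have Q_eq: "Q n z x = z *\<^sub>C F x - G x" if "x \<in> L" for z x
      using FG_n that by blast
    have q: "W * \<epsilon> < \<delta>\<^sup>2 / 2"
    proof -
      have "\<epsilon> * (2 * (2 * \<delta>\<^sup>2 + 3 * \<mu>\<^sup>2) * W) < \<delta>\<^sup>2 * \<mu>\<^sup>2"
        using \<epsilon> W \<mu>_pos unfolding W_def K_def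
        by (subst (asm) pos_less_divide_eq) (auto intro!: mult_pos_pos add_nonneg_pos)
      \<comment> \<open>The admissible bound is below \<open>\<delta>\<^sup>2 / (2 * W)\<close> because \<open>2 * \<delta>\<^sup>2 + 3 * \<mu>\<^sup>2 \<ge> \<mu>\<^sup>2\<close>.\<close>
      moreover have "\<epsilon> * (2 * \<mu>\<^sup>2 * W) \<le> \<epsilon> * (2 * (2 * \<delta>\<^sup>2 + 3 * \<mu>\<^sup>2) * W)"
        using \<epsilon> W by (intro mult_left_mono mult_right_mono) auto
      ultimately have "(W * \<epsilon>) * (2 * \<mu>\<^sup>2) < \<delta>\<^sup>2 / 2 * (2 * \<mu>\<^sup>2)"
        by (simp add: mult_ac)
      thus ?thesis
        using \<mu>_pos by (simp only: mult_less_cancel_right) simp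
    qed
    have residual: "norm (P z (Pr n a) - (z - lam) ^ 2 *\<^sub>C a) \<le> \<delta>\<^sup>2 / 8 * norm a"
      if "a \<in> op_eigenspace D M lam" "cmod (z - lam) \<le> \<mu> / 4" for a z
    proof -
      have "norm (P z (Pr n a) - (z - lam) ^ 2 *\<^sub>C a) \<le> \<eta> n * norm a"
        unfolding \<eta>_def using b K(2) that by (intro residual_le) (simp_all add: Eig_def)
      also have "\<dots> \<le> \<delta>\<^sup>2 / 8 * norm a"
        using N0[of n] n by (intro mult_right_mono) auto
      finally show ?thesis .
    qed
    have Q_le: "norm (Q n z x) \<le> (W * \<epsilon>) * norm x"
      if z: "cmod (z - lam) \<le> \<mu> / 4" and x: "x \<in> L" for z x
    proof -
      have "norm (Q n z x) \<le> cmod z * norm (F x) + norm (G x)"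
        unfolding Q_eq[OF x] by (rule order_trans[OF norm_triangle_ineq4]) (simp add: norm_scaleC)
      also have "\<dots> \<le> K * (w1 * \<epsilon> * norm x) + w0 * \<epsilon> * norm x"
        using norm_le_op_norm_on[OF fin_range F(1) x F(3)] norm_le_op_norm_on[OF fin_range G(1) x G(3)]
          K[OF z] by (intro add_mono mult_mono) auto
      finally show ?thesis
        by (simp add: W_def algebra_simps)
    qed
    have Q_lin: "linear_op_on L (Q n z)" "Q n z ` L \<subseteq> L" for z
    proof -
      have sub: "x + y \<in> L" "a *\<^sub>C x \<in> L" "x - y \<in> L" if "x \<in> L" "y \<in> L" for x y a
        using subspace_L that by (auto intro: complex_vector.subspace_add
            complex_vector.subspace_scale complex_vector.subspace_diff simp del: range_eqI)
      have F_eq: "F (x + y) = F x + F y" "F (a *\<^sub>C x) = a *\<^sub>C F x"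
        and G_eq: "G (x + y) = G x + G y" "G (a *\<^sub>C x) = a *\<^sub>C G x"
        if "x \<in> L" "y \<in> L" for x y a
        using F(1) G(1) that unfolding linear_op_on_def by blast+
      show "linear_op_on L (Q n z)"
        unfolding linear_op_on_def
      proof (intro conjI ballI allI subspace_L)
        fix x y assume xy: "x \<in> L" "y \<in> L"
        show "Q n z (x + y) = Q n z x + Q n z y"
          using xy sub(1)[OF xy] by (simp only: Q_eq F_eq G_eq) (simp add: scaleC_add_right)
      next
        fix a x assume x: "x \<in> L"
        show "Q n z (a *\<^sub>C x) = a *\<^sub>C Q n z x"
          using sub(2)[OF x x] F_eq(2)[OF x x] G_eq(2)[OF x x]
          by (simp only: Q_eq[OF x] Q_eq[OF sub(2)[OF x x]])
            (simp add: scaleC.diff_right scaleC_scaleC mult.commute)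
      qed
      show "Q n z ` L \<subseteq> L"
      proof (rule image_subsetI)
        fix x assume x: "x \<in> L"
        hence "F x \<in> L" "G x \<in> L"
          using F(2) G(2) by blast+
        thus "Q n z x \<in> L"
          unfolding Q_eq[OF x] using subspace_L
          by (intro complex_vector.subspace_diff complex_vector.subspace_scale)
      qed
    qed
    have Q_hol: "(\<lambda>z. cinner x (Q n z y)) holomorphic_on UNIV" if "x \<in> L" "y \<in> L" for x y
      unfolding Q_eq[OF that(2)] cinner.diff_right cinner_scaleC_right
      by (intro holomorphic_intros)
    have \<psi>_le: "norm (Pr n \<psi> - \<psi>) \<le> norm \<psi> / 2"
      using N0[of n] n by (simp add: Pr_idem)
    note conclusions = eigenvalues_of_perturbed_pencil[OF fin[unfolded Eig_def] \<delta> residual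
        \<psi>(1)[unfolded Eig_def] \<psi>(2) \<psi>_le Q_lin Q_hol Q_le q]
    show "let L = range (Pr n);
              P = quadratic_pencil (Pr n) M;
              PQ = (\<lambda>z x. P z x + Q n z x)
          in pencil_spectrum L PQ \<inter> {z. \<delta> \<le> cmod (z - lam) \<and> cmod (z - lam) \<le> \<mu> / 4} = {} \<and>
             pencil_spectrum L PQ \<inter> {z. cmod (z - lam) < \<delta>} \<noteq> {} \<and>
             count_eigenvalues L P {z. cmod (z - lam) < \<delta>} =
               count_eigenvalues L PQ {z. cmod (z - lam) < \<delta>}"
      unfolding Let_def by (intro conjI conclusions)
  qed simp
qed

end
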